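(* Let $k,n$ be integers with $2\leq k<\frac{n}{2}$ and let $2<p\leq\frac{2n}{n-2k}$. There exists a positive constant $C_{n,p}$ such that for each $u\in C^{\infty}_{0}(\mathbb{B}^{n})$, \[ \int_{\mathbb{B}^{n}}(P_{k}u)\,u\,dV- \prod^{k}_{i=1}\frac{(2i-1)^{2}}{4}\int_{\mathbb{B}^{n}}u^{2}\,dV\geq C_{n,p}\left(\int_{\mathbb{B}^{n}}|u|^{p}\,dV\right)^{\frac{2}{p}}. \]
   Context: $\mathbb{B}^{n}=\{x\in\mathbb{R}^{n}:|x|<1\}$ is the Poincaré ball model of hyperbolic space, with metric $ds^{2}=\frac{4(dx_1^2+\cdots+dx_n^2)}{(1-|x|^{2})^{2}}$, volume element $dV=\left(\frac{2}{1-|x|^{2}}\right)^{n}dx$ and Laplace-Beltrami operator $\Delta_{\mathbb{H}}=\frac{1-|x|^{2}}{4}\left\{(1-|x|^{2})\sum_{i=1}^{n}\frac{\partial^{2}}{\partial x_{i}^{2}}+2(n-2)\sum_{i=1}^{n}x_{i}\frac{\partial}{\partial x_{i}}\right\}$. The GJMS operators are $P_{k}=P_{1}(P_{1}+2)\cdots(P_{1}+k(k-1))=\prod_{i=1}^k(P_1+i(i-1))$, where $P_{1}=-\Delta_{\mathbb{H}}-\frac{n(n-2)}{4}$. $C_0^\infty(\mathbb{B}^n)$ denotes smooth (real-valued) functions with compact support in the open ball. *)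

theory Defs
  imports "HOL-Analysis.Analysis"
begin

section \<open>Smooth functions with compact support\<close>

definition partial_deriv :: "'n \<Rightarrow> (real ^ 'n \<Rightarrow> real) \<Rightarrow> real ^ 'n \<Rightarrow> real" where
  "partial_deriv i f x = frechet_derivative f (at x) (axis i 1)"

text \<open>The following two notions are meant for open \<open>S\<close>; they do not depend on the values
  of \<open>f\<close> outside \<open>S\<close>.\<close>

fun Ck_on :: "nat \<Rightarrow> (real ^ 'n) set \<Rightarrow> (real ^ 'n \<Rightarrow> real) \<Rightarrow> bool" where
  "Ck_on 0 S f \<longleftrightarrow> continuous_on S f"
| "Ck_on (Suc m) S f \<longleftrightarrow> (\<forall>x\<in>S. f differentiable (at x)) \<and> (\<forall>i. Ck_on m S (partial_deriv i f))"

definition smooth_on :: "(real ^ 'n) set \<Rightarrow> (real ^ 'n \<Rightarrow> real) \<Rightarrow> bool" where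
  "smooth_on S f \<longleftrightarrow> (\<forall>m. Ck_on m S f)"

text \<open>The space \<open>C\<^sub>0\<^sup>\<infinity>(S)\<close> for open \<open>S\<close>. An element is a function on \<open>S\<close>, so its values outside \<open>S\<close>
  are junk and left unconstrained. The closure is taken in the whole space; requiring it to be
  a compact subset of \<open>S\<close> is the same as compactness of the support relative to \<open>S\<close>.\<close>

definition test_functions :: "(real ^ 'n) set \<Rightarrow> (real ^ 'n \<Rightarrow> real) set" where
  "test_functions S = {u. smooth_on S u \<and>
     compact (closure {x\<in>S. u x \<noteq> 0}) \<and> closure {x\<in>S. u x \<noteq> 0} \<subseteq> S}"

section \<open>The Poincare ball model\<close>

abbreviation poincare_ball :: "(real ^ 'n) set" where
  "poincare_ball \<equiv> ball 0 1"

definition hyp_volume :: "(real ^ 'n) measure" where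
  "hyp_volume = density (restrict_space lborel poincare_ball)
     (\<lambda>x. ennreal ((2 / (1 - (norm x)\<^sup>2)) ^ CARD('n)))"

definition hyp_laplacian :: "(real ^ 'n \<Rightarrow> real) \<Rightarrow> real ^ 'n \<Rightarrow> real" where
  "hyp_laplacian u x = (1 - (norm x)\<^sup>2) / 4 *
     ((1 - (norm x)\<^sup>2) * (\<Sum>i\<in>UNIV. partial_deriv i (partial_deriv i u) x)
      + 2 * (real CARD('n) - 2) * (\<Sum>i\<in>UNIV. x $ i * partial_deriv i u x))"

text \<open>The conformal Laplacian \<open>P\<^sub>1\<close> and the GJMS operators
  \<open>P\<^sub>k = P\<^sub>1 (P\<^sub>1 + 2) \<dots> (P\<^sub>1 + k (k - 1))\<close>, the product being composition of operators; the recursion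
  splits off the rightmost factor, and the factor with index 1 is \<open>P\<^sub>1\<close> itself.\<close>

definition conf_laplacian :: "(real ^ 'n \<Rightarrow> real) \<Rightarrow> real ^ 'n \<Rightarrow> real" where
  "conf_laplacian u x =
     - hyp_laplacian u x - real CARD('n) * (real CARD('n) - 2) / 4 * u x"

fun gjms :: "nat \<Rightarrow> (real ^ 'n \<Rightarrow> real) \<Rightarrow> real ^ 'n \<Rightarrow> real" where
  "gjms 0 u = u"
| "gjms (Suc k) u = gjms k (\<lambda>x. conf_laplacian u x + real (Suc k) * real k * u x)"

end

(*
  Write A for the Laplacian -Delta_H shifted by its spectral gap (n-1)^2/4. Then P_k is the product of
  the factors A + (2i-1)^2/4, so the left-hand side is a positive combination of the forms <A^j u, u>
  with 1 <= j <= k, each of them nonnegative.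

  First order. With rho = (1-|x|^2)/2 and G = rho grad w + (n-1)/2 w x one has
  <A w, w> = int |G|^2 dV + (n-1)/2 int rho w^2 dV. Testing the divergence of a radial field against |w|^t,
  t = q/2+1, bounds int |w|^t dV, and the Gagliardo-Nirenberg inequality in L^1 for rho^(1-n) |w|^t bounds
  int |w|^(tn/(n-1)) dV, both by <A w, w>^(1/2) (int |w|^q dV)^(1/2). Interpolation between the two
  exponents gives |w|_q^2 <= C <A w, w> for 2 < q <= 2n/(n-2).

  Higher order. Testing A f against f |f|^(s-2) and applying the first order inequality to |f|^(s/2)
  bounds |f| in L^(p_j) by |A f| in L^(p_(j-2)) plus |f| in L^(p_(j-1)), where p_j = 2n/(n-2j). Iterating
  this from j = 0, 1 reaches p_k. The L^2 norm of u itself is not controlled by the forms <A^j u, u> with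
  j >= 1, but is never needed.
*)
theory Submission
  imports Defs
begin

text \<open>The obstacle is that the whole spectral gap has been subtracted: A is nonnegative, but
  <A w, w> dominates no positive multiple of int w^2 dV. A Sobolev inequality with an L^2 term on
  the right is therefore useless, and each estimate has to close without one. At first order, t =
  q/2+1 is chosen so that 2(t-1) = q. Cauchy-Schwarz then produces int |w|^q dV itself, and after
  interpolation it stands on the right with a power below one. Compact support makes it finite, so
  it can be absorbed into the left-hand side. At second order, the gradient terms of <A f,
  f|f|^(s-2)> and of <A |f|^(s/2), |f|^(s/2)> carry the factors s-1 and s^2/4, while their zero
  order terms agree. These terms therefore do not cancel, and int |f|^s dV remains. Hoelder splits
  it between the L^(p_(j-1)) norm, which is bounded one stage earlier, and the L^(p_j) norm, to a
  power low enough to be absorbed.\<close>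

section \<open>The Gagliardo--Nirenberg inequality in $L^1$\<close>

text \<open>Line integrals may be infinite before they are integrated further, so Hoelder's
  inequality is run in [0, \<infinity>], without integrability conditions. Sending
  \<open>top\<close> to \<open>top\<close> is the natural convention for the positive exponents that
  occur.\<close>

definition ennreal_powr :: "ennreal \<Rightarrow> real \<Rightarrow> ennreal" where
  "ennreal_powr x a = (if x = top then top else ennreal (enn2real x powr a))"

lemma ennreal_powr_ennreal: "0 \<le> x \<Longrightarrow> ennreal_powr (ennreal x) a = ennreal (x powr a)"
  by (simp add: ennreal_powr_def)

lemma ennreal_powr_top [simp]: "ennreal_powr top a = top"
  by (simp add: ennreal_powr_def)

lemma ennreal_powr_eq_0_iff [simp]: "ennreal_powr x a = 0 \<longleftrightarrow> x = 0"
  by (cases x) (auto simp: ennreal_powr_def ennreal_eq_0_iff)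

lemma ennreal_powr_mono:
  assumes "x \<le> y" "0 \<le> a" shows "ennreal_powr x a \<le> ennreal_powr y a"
proof (cases y)
  case (real r)
  then obtain s where "x = ennreal s" "0 \<le> s"
    using assms(1) by (cases x) (auto simp: top_unique)
  then show ?thesis
    using assms real by (auto simp: ennreal_powr_ennreal intro!: ennreal_leI powr_mono2)
qed simp

lemma borel_measurable_ennreal_powr [measurable]:
  assumes [measurable]: "f \<in> borel_measurable M"
  shows "(\<lambda>x. ennreal_powr (f x) a) \<in> borel_measurable M"
  unfolding ennreal_powr_def by measurable

section \<open>Hoelder's inequality for several functions with equal exponents\<close>

lemma weighted_am_gm:
  fixes a :: "'i \<Rightarrow> real"
  assumes "finite S" "S \<noteq> {}" "\<And>i. i \<in> S \<Longrightarrow> 0 \<le> a i"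
  shows "(\<Prod>i\<in>S. a i powr (1 / card S)) \<le> (\<Sum>i\<in>S. a i) / card S"
  using arith_geom_mean[OF assms] by (simp add: prod_powr_distrib sum_divide_distrib)

lemma prod_mono_ennreal:
  fixes f g :: "'i \<Rightarrow> ennreal"
  assumes "\<And>i. i \<in> A \<Longrightarrow> f i \<le> g i"
  shows "prod f A \<le> prod g A"
  using assms by (induction A rule: infinite_finite_induct) (auto intro!: mult_mono)

text \<open>Once each function is divided by its integral, the pointwise AM-GM inequality bounds the
  product by an average whose integral is 1. The division needs integrals that are neither zero nor
  infinite, hence the three cases.\<close>

lemma nn_integral_prod_powr_le:
  assumes S: "finite S" "S \<noteq> {}" and [measurable]: "\<And>i. i \<in> S \<Longrightarrow> f i \<in> borel_measurable M"
  shows "(\<integral>\<^sup>+x. (\<Prod>i\<in>S. ennreal_powr (f i x) (1 / card S)) \<partial>M)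
    \<le> (\<Prod>i\<in>S. ennreal_powr (\<integral>\<^sup>+x. f i x \<partial>M) (1 / card S))"
proof -
  define r where "r = 1 / real (card S)"
  have r: "0 < r"
    using S by (simp add: r_def card_gt_0_iff)
  consider i where "i \<in> S" "(\<integral>\<^sup>+x. f i x \<partial>M) = 0"
    | i where "i \<in> S" "\<And>i. i \<in> S \<Longrightarrow> (\<integral>\<^sup>+x. f i x \<partial>M) \<noteq> 0" "(\<integral>\<^sup>+x. f i x \<partial>M) = top"
    | "\<And>i. i \<in> S \<Longrightarrow> (\<integral>\<^sup>+x. f i x \<partial>M) \<noteq> 0 \<and> (\<integral>\<^sup>+x. f i x \<partial>M) \<noteq> top"
    by blast
  then show ?thesis
  proof cases
    case 1
    then have "AE x in M. f i x = 0"
      by (subst (asm) nn_integral_0_iff_AE) auto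
    then have "AE x in M. (\<Prod>i\<in>S. ennreal_powr (f i x) r) = 0"
      by eventually_elim (use 1 S in auto)
    then have "(\<integral>\<^sup>+x. (\<Prod>i\<in>S. ennreal_powr (f i x) r) \<partial>M) = 0"
      by (subst nn_integral_0_iff_AE) auto
    then show ?thesis
      by (simp add: r_def)
  next
    case 2
    \<comment> \<open>Vanishing integrals belong to the previous case; otherwise an infinite factor
      could meet a zero one, and \<open>0 * top\<close> is 0.\<close>
    then have "(\<Prod>j\<in>S - {i}. ennreal_powr (\<integral>\<^sup>+x. f j x \<partial>M) r) \<noteq> 0"
      using S by simp
    then have "(\<Prod>j\<in>S. ennreal_powr (\<integral>\<^sup>+x. f j x \<partial>M) r) = top"
      using S 2 by (subst prod.remove[of _ i]) (auto simp: ennreal_top_mult)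
    then show ?thesis
      by (simp add: r_def)
  next
    case 3
    define I where "I i = enn2real (\<integral>\<^sup>+x. f i x \<partial>M)" for i
    have I: "(\<integral>\<^sup>+x. f i x \<partial>M) = ennreal (I i)" "0 < I i" if "i \<in> S" for i
    proof -
      show "(\<integral>\<^sup>+x. f i x \<partial>M) = ennreal (I i)"
        using 3[OF that] by (simp add: I_def less_top)
      then show "0 < I i"
        using 3[OF that] by (auto simp: I_def enn2real_positive_iff less_top zero_less_iff_neq_zero)
    qed
    have "AE x in M. f i x \<noteq> top" if "i \<in> S" for i
      using 3[OF that] that nn_integral_PInf_AE[of "f i" M] by simp
    then have "AE x in M. \<forall>i\<in>S. f i x \<noteq> top"
      by (rule AE_finite_allI[OF S(1)])
    then have "AE x in M. (\<Prod>i\<in>S. ennreal_powr (f i x) r)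
      \<le> (\<Prod>i\<in>S. ennreal (I i powr r)) * (\<Sum>i\<in>S. f i x * ennreal (r / I i))"
    proof eventually_elim
      case (elim x)
      define a where "a i = enn2real (f i x)" for i
      have a: "f i x = ennreal (a i)" "0 \<le> a i" if "i \<in> S" for i
        using elim that by (auto simp: a_def less_top enn2real_nonneg)
      have "(\<Prod>i\<in>S. a i powr r) = (\<Prod>i\<in>S. I i powr r * (a i / I i) powr r)"
        using I(2) a by (intro prod.cong) (auto simp: less_imp_neq[THEN not_sym] simp flip: powr_mult)
      also have "\<dots> = (\<Prod>i\<in>S. I i powr r) * (\<Prod>i\<in>S. (a i / I i) powr r)"
        by (simp add: prod.distrib)
      also have "\<dots> \<le> (\<Prod>i\<in>S. I i powr r) * (\<Sum>i\<in>S. a i * (r / I i))"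
        using weighted_am_gm[OF S, of "\<lambda>i. a i / I i"] a I
        by (intro mult_left_mono prod_nonneg)
           (auto simp: r_def sum_divide_distrib less_imp_le mult.commute)
      finally have *: "(\<Prod>i\<in>S. a i powr r) \<le> (\<Prod>i\<in>S. I i powr r) * (\<Sum>i\<in>S. a i * (r / I i))" .
      have "(\<Prod>i\<in>S. ennreal_powr (f i x) r) = ennreal (\<Prod>i\<in>S. a i powr r)"
        using a by (simp add: ennreal_powr_ennreal flip: prod_ennreal)
      also have "\<dots> \<le> ennreal ((\<Prod>i\<in>S. I i powr r) * (\<Sum>i\<in>S. a i * (r / I i)))"
        using * by (rule ennreal_leI)
      also have "\<dots> = (\<Prod>i\<in>S. ennreal (I i powr r)) * (\<Sum>i\<in>S. f i x * ennreal (r / I i))"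
        using a I(2) r
        by (subst ennreal_mult) (auto simp: prod_ennreal sum_ennreal less_imp_le sum_nonneg prod_nonneg
            simp flip: ennreal_mult intro!: sum.cong arg_cong2[where f="(*)"])
      finally show ?case .
    qed
    then have "(\<integral>\<^sup>+x. (\<Prod>i\<in>S. ennreal_powr (f i x) r) \<partial>M)
      \<le> (\<integral>\<^sup>+x. (\<Prod>i\<in>S. ennreal (I i powr r)) * (\<Sum>i\<in>S. f i x * ennreal (r / I i)) \<partial>M)"
      by (rule nn_integral_mono_AE)
    also have "\<dots> = (\<Prod>i\<in>S. ennreal (I i powr r)) * (\<Sum>i\<in>S. ennreal (I i) * ennreal (r / I i))"
      by (simp add: nn_integral_cmult nn_integral_sum nn_integral_multc I)
    also have "(\<Sum>i\<in>S. ennreal (I i) * ennreal (r / I i)) = (\<Sum>i\<in>S. ennreal r)"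
      using I r by (intro sum.cong) (auto simp: less_imp_le less_imp_neq[THEN not_sym] simp flip: ennreal_mult)
    also have "\<dots> = ennreal (\<Sum>i\<in>S. r)"
      using r by (subst sum_ennreal) auto
    also have "(\<Sum>i\<in>S. r) = 1"
      using S by (simp add: r_def)
    finally show ?thesis
      by (simp add: r_def I ennreal_powr_ennreal less_imp_le cong: prod.cong)
  qed
qed

section \<open>Integration over a subset of the coordinates\<close>

definition coord_upd :: "'a::euclidean_space \<Rightarrow> 'a \<Rightarrow> real \<Rightarrow> 'a" where
  "coord_upd x b s = x + (s - x \<bullet> b) *\<^sub>R b"

text \<open>The result is again a function of the whole point, constant in the directions of
  \<open>J\<close>. Coordinates can thus be integrated out one at a time without changing the
  type.\<close>

definition partial_integral :: "'a::euclidean_space set \<Rightarrow> ('a \<Rightarrow> ennreal) \<Rightarrow> 'a \<Rightarrow> ennreal" where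
  "partial_integral J h x =
     (\<integral>\<^sup>+f. h (\<Sum>b\<in>Basis. (if b \<in> J then f b else x \<bullet> b) *\<^sub>R b) \<partial>(\<Pi>\<^sub>M b\<in>J. lborel))"

lemma coord_upd_inner:
  "b \<in> Basis \<Longrightarrow> i \<in> Basis \<Longrightarrow> coord_upd x b s \<bullet> i = (if i = b then s else x \<bullet> i)"
  by (auto simp: coord_upd_def inner_add_left inner_Basis)

lemma continuous_on_coord_upd [continuous_intros]:
  assumes "continuous_on S f" "continuous_on S g"
  shows "continuous_on S (\<lambda>x. coord_upd (f x) b (g x))"
  unfolding coord_upd_def by (intro continuous_intros assms)

lemma measurable_coord_upd [measurable (raw)]:
  assumes [measurable]: "f \<in> borel_measurable M" "g \<in> borel_measurable M"
  shows "(\<lambda>x. coord_upd (f x) b (g x)) \<in> borel_measurable M"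
  unfolding coord_upd_def by measurable

lemma partial_integral_empty [simp]: "partial_integral {} h x = h x"
  by (simp add: partial_integral_def nn_integral_count_space_finite PiM_empty euclidean_representation)

text \<open>Tonelli's theorem with the new coordinate outermost or innermost. The first form drives
  inductions on \<open>J\<close>; the second recognises a partial integral of line integrals as an
  integral over one more coordinate.\<close>

lemma
  fixes h :: "'a::euclidean_space \<Rightarrow> ennreal"
  assumes [measurable]: "h \<in> borel_measurable borel"
    and J: "insert j J \<subseteq> Basis" "j \<notin> J"
  shows partial_integral_insert:
      "partial_integral (insert j J) h x = (\<integral>\<^sup>+s. partial_integral J h (coord_upd x j s) \<partial>lborel)"
    and partial_integral_insert':
      "partial_integral (insert j J) h x
        = partial_integral J (\<lambda>y. \<integral>\<^sup>+s. h (coord_upd y j s) \<partial>lborel) x"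
proof -
  interpret product_sigma_finite "\<lambda>b::'a. lborel :: real measure"
    by standard
  have [simp]: "finite J"
    using J finite_subset[OF _ finite_Basis] by auto
  have meas: "(\<lambda>f. h (\<Sum>b\<in>Basis. (if b \<in> insert j J then f b else x \<bullet> b) *\<^sub>R b))
      \<in> borel_measurable (Pi\<^sub>M (insert j J) (\<lambda>b. lborel))"
  proof -
    have "(\<lambda>f. (if b \<in> insert j J then f b else x \<bullet> b) *\<^sub>R b)
      \<in> borel_measurable (Pi\<^sub>M (insert j J) (\<lambda>b. lborel))" for b
      by (cases "b \<in> insert j J") (simp_all del: insert_iff)
    then have "(\<lambda>f. \<Sum>b\<in>Basis. (if b \<in> insert j J then f b else x \<bullet> b) *\<^sub>R b)
      \<in> borel_measurable (Pi\<^sub>M (insert j J) (\<lambda>b. lborel))"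
      by (intro borel_measurable_sum)
    then show ?thesis
      by (rule measurable_compose) fact
  qed
  have "partial_integral (insert j J) h x
    = (\<integral>\<^sup>+s. (\<integral>\<^sup>+f. h (\<Sum>b\<in>Basis. (if b \<in> insert j J then (f(j := s)) b else x \<bullet> b) *\<^sub>R b)
        \<partial>(\<Pi>\<^sub>M b\<in>J. lborel)) \<partial>lborel)"
    using product_nn_integral_insert_rev[OF \<open>finite J\<close> J(2) meas] by (simp only: partial_integral_def)
  also have "\<dots> = (\<integral>\<^sup>+s. partial_integral J h (coord_upd x j s) \<partial>lborel)"
    unfolding partial_integral_def
  proof (intro nn_integral_cong arg_cong[where f=h], goal_cases)
    case (1 s f)
    show ?case
      using J by (intro sum.cong) (auto simp: coord_upd_inner)
  qed
  finally show "partial_integral (insert j J) h x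
    = (\<integral>\<^sup>+s. partial_integral J h (coord_upd x j s) \<partial>lborel)" .
  have "partial_integral (insert j J) h x
    = (\<integral>\<^sup>+f. (\<integral>\<^sup>+s. h (\<Sum>b\<in>Basis. (if b \<in> insert j J then (f(j := s)) b else x \<bullet> b) *\<^sub>R b)
        \<partial>lborel) \<partial>(\<Pi>\<^sub>M b\<in>J. lborel))"
    using product_nn_integral_insert[OF \<open>finite J\<close> J(2) meas] by (simp only: partial_integral_def)
  also have "\<dots> = partial_integral J (\<lambda>y. \<integral>\<^sup>+s. h (coord_upd y j s) \<partial>lborel) x"
    unfolding partial_integral_def
  proof (intro nn_integral_cong arg_cong[where f=h], goal_cases)
    case (1 f s)
    show ?case
      using J by (intro euclidean_eqI[where 'a='a]) (auto simp: coord_upd_inner inner_sum_left_Basis)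
  qed
  finally show "partial_integral (insert j J) h x
    = partial_integral J (\<lambda>y. \<integral>\<^sup>+s. h (coord_upd y j s) \<partial>lborel) x" .
qed

lemma partial_integral_Basis:
  fixes h :: "'a::euclidean_space \<Rightarrow> ennreal"
  assumes [measurable]: "h \<in> borel_measurable borel"
  shows "partial_integral Basis h x = (\<integral>\<^sup>+x. h x \<partial>lborel)"
  unfolding partial_integral_def by (subst lborel_eq) (simp add: nn_integral_distr cong: sum.cong)

lemma measurable_partial_integral [measurable]:
  fixes h :: "'a::euclidean_space \<Rightarrow> ennreal"
  assumes "J \<subseteq> Basis" and "h \<in> borel_measurable borel"
  shows "partial_integral J h \<in> borel_measurable borel"
proof -
  have "finite J"
    using assms finite_subset[OF _ finite_Basis] by auto
  then show ?thesis
    using assms(1)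
  proof (induction J)
    case empty
    have "partial_integral {} h = h"
      by auto
    then show ?case
      using assms by simp
  next
    case (insert j J)
    have [measurable]: "partial_integral J h \<in> borel_measurable borel"
      using insert by auto
    have "partial_integral (insert j J) h
      = (\<lambda>x. \<integral>\<^sup>+s. partial_integral J h (coord_upd x j s) \<partial>lborel)"
      using insert by (intro ext partial_integral_insert assms) auto
    moreover have "(\<lambda>x. \<integral>\<^sup>+s. partial_integral J h (coord_upd x j s) \<partial>lborel) \<in> borel_measurable borel"
      by measurable
    ultimately show ?case
      by (simp only:)
  qed
qed

text \<open>This is what allows the \<open>j\<close>-th factor of a product to be pulled out of the
  integral over the \<open>j\<close>-th coordinate.\<close>

lemma partial_integral_const_coord:
  fixes h :: "'a::euclidean_space \<Rightarrow> ennreal"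
  assumes "J \<subseteq> Basis" "j \<in> Basis" "j \<notin> J" "\<And>x s. h (coord_upd x j s) = h x"
  shows "partial_integral J h (coord_upd x j s) = partial_integral J h x"
  unfolding partial_integral_def
proof (intro nn_integral_cong, goal_cases)
  case (1 f)
  have "(\<Sum>b\<in>Basis. (if b \<in> J then f b else coord_upd x j s \<bullet> b) *\<^sub>R b)
    = coord_upd (\<Sum>b\<in>Basis. (if b \<in> J then f b else x \<bullet> b) *\<^sub>R b) j s"
    using assms by (intro euclidean_eqI[where 'a='a]) (auto simp: coord_upd_inner inner_sum_left_Basis)
  then show ?case
    using assms by simp
qed

text \<open>For \<open>J = Basis\<close> this is the Loomis--Whitney inequality. Adding a coordinate \<open>j\<close> to \<open>J\<close> leaves
  the \<open>j\<close>-th factor alone, so that Hoelder's inequality is only needed for the other \<open>DIM('a) - 1\<close>.\<close>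
lemma partial_integral_prod_le:
  fixes f :: "'a::euclidean_space \<Rightarrow> 'a \<Rightarrow> ennreal"
  assumes dim: "2 \<le> DIM('a)"
    and f [measurable]: "\<And>i. i \<in> Basis \<Longrightarrow> f i \<in> borel_measurable borel"
    and const: "\<And>i x s. i \<in> Basis \<Longrightarrow> f i (coord_upd x i s) = f i x"
    and J: "J \<subseteq> Basis"
  defines "\<theta> \<equiv> 1 / (real DIM('a) - 1)"
  shows "partial_integral J (\<lambda>x. \<Prod>i\<in>Basis. ennreal_powr (f i x) \<theta>) x
    \<le> (\<Prod>i\<in>Basis. ennreal_powr (partial_integral (J - {i}) (f i) x) \<theta>)"
proof -
  have "finite J"
    using J finite_subset[OF _ finite_Basis] by auto
  then show ?thesis
    using J
  proof (induction J arbitrary: x)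
    case empty
    then show ?case
      by simp
  next
    case (insert j J)
    let ?S = "Basis - {j}"
    let ?p = "\<lambda>i. partial_integral (J - {i}) (f i)"
    have j: "j \<in> Basis" "J \<subseteq> Basis"
      using insert by auto
    have card: "\<theta> = 1 / card ?S"
      using j dim by (simp add: \<theta>_def of_nat_diff)
    have nonempty: "?S \<noteq> {}"
    proof -
      have "card ?S \<noteq> 0"
        using dim j by (subst card_Diff_singleton) auto
      then show ?thesis
        by (metis card.empty)
    qed
    have [measurable]: "?p i \<in> borel_measurable borel" if "i \<in> Basis" for i
      using that j f by (intro measurable_partial_integral) auto
    have const_j: "?p j (coord_upd x j s) = ?p j x" for s
      using insert j const by (intro partial_integral_const_coord) auto
    have "partial_integral (insert j J) (\<lambda>x. \<Prod>i\<in>Basis. ennreal_powr (f i x) \<theta>) x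
      = (\<integral>\<^sup>+s. partial_integral J (\<lambda>x. \<Prod>i\<in>Basis. ennreal_powr (f i x) \<theta>) (coord_upd x j s) \<partial>lborel)"
      using insert by (intro partial_integral_insert) auto
    also have "\<dots> \<le> (\<integral>\<^sup>+s. (\<Prod>i\<in>Basis. ennreal_powr (?p i (coord_upd x j s)) \<theta>) \<partial>lborel)"
      using insert by (intro nn_integral_mono) auto
    also have "\<dots> = (\<integral>\<^sup>+s. ennreal_powr (?p j x) \<theta>
        * (\<Prod>i\<in>?S. ennreal_powr (?p i (coord_upd x j s)) \<theta>) \<partial>lborel)"
      using j by (intro nn_integral_cong) (simp add: prod.remove const_j)
    also have "\<dots> = ennreal_powr (?p j x) \<theta>
        * (\<integral>\<^sup>+s. (\<Prod>i\<in>?S. ennreal_powr (?p i (coord_upd x j s)) \<theta>) \<partial>lborel)"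
      by (intro nn_integral_cmult) auto
    also have "\<dots> \<le> ennreal_powr (?p j x) \<theta>
        * (\<Prod>i\<in>?S. ennreal_powr (\<integral>\<^sup>+s. ?p i (coord_upd x j s) \<partial>lborel) \<theta>)"
      unfolding card by (intro mult_left_mono nn_integral_prod_powr_le nonempty) auto
    also have "\<dots> = (\<Prod>i\<in>Basis. ennreal_powr (partial_integral (insert j J - {i}) (f i) x) \<theta>)"
    proof -
      have "(\<integral>\<^sup>+s. ?p i (coord_upd x j s) \<partial>lborel) = partial_integral (insert j J - {i}) (f i) x"
        if "i \<in> ?S" for i
      proof -
        have "insert j J - {i} = insert j (J - {i})"
          using that by auto
        then show ?thesis
          using insert that by (subst partial_integral_insert[symmetric]) auto
      qed
      moreover have "insert j J - {j} = J - {j}"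
        by auto
      ultimately show ?thesis
        using j by (subst (2) prod.remove[of _ j]) auto
    qed
    finally show ?case .
  qed
qed

lemma gagliardo_nirenberg_line:
  fixes F :: "'a::euclidean_space \<Rightarrow> real"
  assumes F: "\<And>x. GDERIV F x :> G x" and G: "continuous_on UNIV G"
    and supp: "compact K" "\<And>x. x \<notin> K \<Longrightarrow> F x = 0" and b: "b \<in> Basis"
  shows "ennreal \<bar>F x\<bar> \<le> (\<integral>\<^sup>+s. ennreal \<bar>G (coord_upd x b s) \<bullet> b\<bar> \<partial>lborel)"
proof -
  define \<phi> where "\<phi> s = F (coord_upd x b s)" for s
  define \<phi>' where "\<phi>' s = G (coord_upd x b s) \<bullet> b" for s
  obtain R where R: "\<And>y. y \<in> K \<Longrightarrow> norm y \<le> R"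
    using compact_imp_bounded[OF supp(1)] by (auto simp: bounded_iff)
  \<comment> \<open>The fundamental theorem of calculus is applied on the line through
    \<open>x\<close> from \<open>a\<close> to \<open>x \<bullet> b\<close>: \<open>a\<close> must
    lie to the left of \<open>x\<close> and have absolute value above the radius of the
    support.\<close>
  define a where "a = min (x \<bullet> b) (- \<bar>R\<bar> - 1)"
  have "\<bar>coord_upd x b a \<bullet> b\<bar> > R"
    using b by (auto simp: coord_upd_inner a_def)
  then have "coord_upd x b a \<notin> K"
    using R Basis_le_norm[OF b, of "coord_upd x b a"] by force
  then have a: "\<phi> a = 0" "a \<le> x \<bullet> b"
    using supp by (auto simp: \<phi>_def a_def)
  have deriv: "(\<phi> has_real_derivative \<phi>' s) (at s)" for s
  proof -
    have "((\<lambda>s. coord_upd x b s) has_derivative (\<lambda>h. h *\<^sub>R b)) (at s)"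
      unfolding coord_upd_def by (auto intro!: derivative_eq_intros)
    from has_derivative_compose[OF this F[unfolded gderiv_def]]
    have "(\<phi> has_derivative (\<lambda>h. (h *\<^sub>R b) \<bullet> G (coord_upd x b s))) (at s)"
      unfolding \<phi>_def .
    then show ?thesis
      by (simp add: has_field_derivative_def \<phi>'_def inner_commute mult_commute_abs)
  qed
  have cont: "continuous_on UNIV \<phi>'"
    unfolding \<phi>'_def by (intro continuous_intros continuous_on_compose2[OF G]) auto
  have "has_bochner_integral lborel (\<lambda>s. indicator {a..x \<bullet> b} s *\<^sub>R \<phi>' s) (\<phi> (x \<bullet> b) - \<phi> a)"
    using a deriv continuous_on_subset[OF cont]
    by (intro has_bochner_integral_FTC_Icc)
       (auto simp: has_real_derivative_iff_has_vector_derivative intro: has_vector_derivative_at_within)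
  moreover have "\<phi> (x \<bullet> b) = F x"
    by (simp add: \<phi>_def coord_upd_def)
  ultimately have "has_bochner_integral lborel (\<lambda>s. indicator {a..x \<bullet> b} s *\<^sub>R \<phi>' s) (F x)"
    using a by simp
  then have "ennreal (norm (F x)) \<le> (\<integral>\<^sup>+s. norm (indicator {a..x \<bullet> b} s *\<^sub>R \<phi>' s) \<partial>lborel)"
    by (metis has_bochner_integral_iff integral_norm_bound_ennreal)
  also have "\<dots> \<le> (\<integral>\<^sup>+s. ennreal \<bar>\<phi>' s\<bar> \<partial>lborel)"
    by (intro nn_integral_mono ennreal_leI) (auto split: split_indicator)
  finally show ?thesis
    by (simp add: \<phi>'_def)
qed

text \<open>Each \<open>\<bar>F x\<bar>\<close> is bounded by the integral \<open>f b x\<close> of a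
  partial derivative along the line in direction \<open>b\<close>, which does not depend on the
  \<open>b\<close>-th coordinate. Multiplying these bounds over all directions, each to the power
  1/(n-1), gives a product of the Loomis-Whitney form. Integrating \<open>f b\<close> over the
  remaining coordinates gives back the full integral of the partial derivative.\<close>

theorem gagliardo_nirenberg:
  fixes F :: "'a::euclidean_space \<Rightarrow> real"
  assumes dim: "2 \<le> DIM('a)"
    and F: "\<And>x. GDERIV F x :> G x" and G: "continuous_on UNIV G"
    and supp: "compact K" "\<And>x. x \<notin> K \<Longrightarrow> F x = 0"
    and M: "\<And>b. b \<in> Basis \<Longrightarrow> (\<integral>\<^sup>+x. ennreal \<bar>G x \<bullet> b\<bar> \<partial>lborel) \<le> ennreal M" and "0 \<le> M"
  defines "\<sigma> \<equiv> real DIM('a) / (real DIM('a) - 1)"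
  shows "(\<integral>\<^sup>+x. ennreal (\<bar>F x\<bar> powr \<sigma>) \<partial>lborel) \<le> ennreal (M powr \<sigma>)"
proof -
  define \<theta> where "\<theta> = 1 / (real DIM('a) - 1)"
  have \<theta>: "0 < \<theta>" "\<sigma> = real DIM('a) * \<theta>"
    using dim by (auto simp: \<theta>_def \<sigma>_def)
  have prod_powr: "(\<Prod>b\<in>(Basis::'a set). y powr \<theta>) = y powr \<sigma>" if "0 \<le> y" for y :: real
    using that \<theta> by (cases "y = 0") (auto simp: powr_power mult.commute)
  define g where "g b x = ennreal \<bar>G x \<bullet> b\<bar>" for b x
  define f where "f b x = (\<integral>\<^sup>+s. g b (coord_upd x b s) \<partial>lborel)" for b x
  have [measurable]: "G \<in> borel_measurable borel"
    using G by (rule borel_measurable_continuous_onI)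
  have [measurable]: "g b \<in> borel_measurable borel" for b
    unfolding g_def by measurable
  have [measurable]: "f b \<in> borel_measurable borel" for b
    unfolding f_def by measurable
  have "(\<integral>\<^sup>+x. ennreal (\<bar>F x\<bar> powr \<sigma>) \<partial>lborel)
    \<le> (\<integral>\<^sup>+x. (\<Prod>b\<in>Basis. ennreal_powr (f b x) \<theta>) \<partial>lborel)"
  proof (rule nn_integral_mono)
    fix x
    have "ennreal (\<bar>F x\<bar> powr \<sigma>) = (\<Prod>b\<in>(Basis::'a set). ennreal_powr (ennreal \<bar>F x\<bar>) \<theta>)"
      using prod_powr[of "\<bar>F x\<bar>"] by (simp add: ennreal_powr_ennreal ennreal_power)
    also have "\<dots> \<le> (\<Prod>b\<in>Basis. ennreal_powr (f b x) \<theta>)"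
      using \<theta> gagliardo_nirenberg_line[OF F G supp]
      by (intro prod_mono_ennreal ennreal_powr_mono) (auto simp: f_def g_def)
    finally show "ennreal (\<bar>F x\<bar> powr \<sigma>) \<le> (\<Prod>b\<in>Basis. ennreal_powr (f b x) \<theta>)" .
  qed
  also have "\<dots> = partial_integral Basis (\<lambda>x. \<Prod>b\<in>Basis. ennreal_powr (f b x) \<theta>) 0"
    by (simp add: partial_integral_Basis)
  also have "\<dots> \<le> (\<Prod>b\<in>Basis. ennreal_powr (partial_integral (Basis - {b}) (f b) 0) \<theta>)"
    unfolding \<theta>_def using dim
  proof (rule partial_integral_prod_le)
    fix b x s assume "b \<in> (Basis :: 'a set)"
    then have "coord_upd (coord_upd x b s) b r = coord_upd x b r" for r
      by (intro euclidean_eqI[where 'a='a]) (auto simp: coord_upd_inner)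
    then show "f b (coord_upd x b s) = f b x"
      by (simp add: f_def)
  qed auto
  also have "\<dots> \<le> (\<Prod>b\<in>(Basis::'a set). ennreal_powr (ennreal M) \<theta>)"
  proof (intro prod_mono_ennreal ennreal_powr_mono)
    fix b :: 'a assume b: "b \<in> Basis"
    have "partial_integral (Basis - {b}) (f b) 0 = partial_integral (insert b (Basis - {b})) (g b) 0"
      using b unfolding f_def by (subst partial_integral_insert') auto
    also have "\<dots> = (\<integral>\<^sup>+x. g b x \<partial>lborel)"
      using b by (simp add: insert_absorb partial_integral_Basis)
    finally show "partial_integral (Basis - {b}) (f b) 0 \<le> ennreal M"
      using M[OF b] by (simp add: g_def)
  qed (use \<theta> in auto)
  also have "\<dots> = ennreal (M powr \<sigma>)"
    using prod_powr[OF \<open>0 \<le> M\<close>] \<open>0 \<le> M\<close> by (simp add: ennreal_powr_ennreal ennreal_power)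
  finally show ?thesis .
qed

section \<open>Functions with compact support in the ball\<close>

lemma gderiv_unique:
  assumes "GDERIV f x :> D" "GDERIV f x :> D'"
  shows "D = D'"
proof -
  have "(\<lambda>h. h \<bullet> D) = (\<lambda>h. h \<bullet> D')"
    using assms unfolding gderiv_def by (rule has_derivative_unique)
  then show ?thesis
    by (metis inner_commute vector_eq_rdot)
qed

text \<open>Negative powers of 1-|x|^2 blow up at the unit sphere. A compact set inside the ball
  keeps all weighted integrands continuous with compact support, so integrability follows from
  closure rules alone.\<close>

definition cc_ball :: "(real ^ 'n \<Rightarrow> 'b::real_normed_vector) \<Rightarrow> bool" where
  "cc_ball f \<longleftrightarrow> continuous_on UNIV f \<and>
    (\<exists>K. compact K \<and> K \<subseteq> poincare_ball \<and> (\<forall>x. x \<notin> K \<longrightarrow> f x = 0))"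

text \<open>The gradient is an explicit argument, so that products and powers carry the formula for
  their gradient along with them.\<close>

definition C1c_ball :: "(real ^ 'n \<Rightarrow> real) \<Rightarrow> (real ^ 'n \<Rightarrow> real ^ 'n) \<Rightarrow> bool" where
  "C1c_ball f g \<longleftrightarrow> (\<forall>x. GDERIV f x :> g x) \<and> continuous_on UNIV g \<and>
    (\<exists>K. compact K \<and> K \<subseteq> poincare_ball \<and> (\<forall>x. x \<notin> K \<longrightarrow> f x = 0))"

lemma continuous_on_cc_glue:
  fixes f :: "'a::t2_space \<Rightarrow> 'b::{topological_space, zero}"
  assumes "open S" "compact K" "K \<subseteq> S" "continuous_on S f" "\<And>x. x \<notin> K \<Longrightarrow> f x = 0"
  shows "continuous_on UNIV f"
proof -
  have "continuous_on (- K) f"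
    using assms(5) by (subst continuous_on_cong[OF refl, of _ _ "\<lambda>x. 0"]) auto
  moreover have "open (- K)"
    using assms(2) by (simp add: compact_imp_closed open_Compl)
  ultimately have "continuous_on (S \<union> - K) f"
    using assms by (intro continuous_on_open_Un) auto
  moreover have "S \<union> - K = UNIV"
    using assms(3) by auto
  ultimately show ?thesis
    by simp
qed

lemma cc_ballI:
  assumes "compact K" "K \<subseteq> poincare_ball" "continuous_on poincare_ball f" "\<And>x. x \<notin> K \<Longrightarrow> f x = 0"
  shows "cc_ball f"
  unfolding cc_ball_def
proof
  show "continuous_on UNIV f"
    by (rule continuous_on_cc_glue[OF open_ball assms])
  show "\<exists>K. compact K \<and> K \<subseteq> poincare_ball \<and> (\<forall>x. x \<notin> K \<longrightarrow> f x = 0)"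
    using assms by blast
qed

lemma cc_ball_continuous: "cc_ball f \<Longrightarrow> continuous_on S f"
  by (auto simp: cc_ball_def intro: continuous_on_subset)

lemma cc_ball_outside: "cc_ball f \<Longrightarrow> x \<notin> poincare_ball \<Longrightarrow> f x = 0"
  by (auto simp: cc_ball_def)

text \<open>The common source of the closure rules below that start from one function:
  \<open>g\<close> inherits the compact set of \<open>f\<close>, and continuity is only to be
  checked inside the ball.\<close>

lemma cc_ball_vanish:
  assumes "cc_ball f" "continuous_on poincare_ball g" "\<And>x. f x = 0 \<Longrightarrow> g x = 0"
  shows "cc_ball g"
proof -
  obtain K where "compact K" "K \<subseteq> poincare_ball" "\<And>x. x \<notin> K \<Longrightarrow> f x = 0"
    using assms(1) by (auto simp: cc_ball_def)
  then show ?thesis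
    using assms by (intro cc_ballI[of K]) auto
qed

lemma cc_ball_add: 
  assumes "cc_ball f" "cc_ball g" shows "cc_ball (\<lambda>x. f x + g x)"
proof -
  obtain K L where "compact K" "K \<subseteq> poincare_ball" "\<And>x. x \<notin> K \<Longrightarrow> f x = 0"
    "compact L" "L \<subseteq> poincare_ball" "\<And>x. x \<notin> L \<Longrightarrow> g x = 0"
    using assms by (auto simp: cc_ball_def)
  then show ?thesis
    using assms by (intro cc_ballI[of "K \<union> L"]) (auto intro!: continuous_intros simp: cc_ball_continuous)
qed

lemma cc_ball_mult:
  fixes f h :: "real ^ 'n \<Rightarrow> real"
  assumes "cc_ball f" "continuous_on poincare_ball h"
  shows "cc_ball (\<lambda>x. h x * f x)"
  by (rule cc_ball_vanish[OF assms(1)]) (auto intro!: continuous_intros assms cc_ball_continuous[OF assms(1)])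

lemma cc_ball_inner:
  fixes f h :: "real ^ 'n \<Rightarrow> real ^ 'n"
  assumes "cc_ball f" "continuous_on poincare_ball h"
  shows "cc_ball (\<lambda>x. f x \<bullet> h x)"
  by (rule cc_ball_vanish[OF assms(1)]) (auto intro!: continuous_intros assms cc_ball_continuous[OF assms(1)])

lemma cc_ball_component:
  fixes f :: "real ^ 'n \<Rightarrow> real ^ 'm"
  assumes "cc_ball f"
  shows "cc_ball (\<lambda>x. f x $ i)"
  by (rule cc_ball_vanish[OF assms(1)]) (auto intro!: continuous_intros assms cc_ball_continuous[OF assms(1)])

lemma cc_ball_norm:
  assumes "cc_ball f" shows "cc_ball (\<lambda>x. norm (f x))"
  by (rule cc_ball_vanish[OF assms]) (auto intro!: continuous_on_norm cc_ball_continuous[OF assms])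

lemma cc_ball_scaleR:
  fixes h :: "real ^ 'n \<Rightarrow> real" and f :: "real ^ 'n \<Rightarrow> 'b::real_normed_vector"
  assumes "cc_ball f" "continuous_on poincare_ball h"
  shows "cc_ball (\<lambda>x. h x *\<^sub>R f x)"
  by (rule cc_ball_vanish[OF assms(1)]) (auto intro!: continuous_intros assms cc_ball_continuous[OF assms(1)])

lemma cc_ball_scaleR':
  fixes h :: "real ^ 'n \<Rightarrow> real" and f :: "real ^ 'n \<Rightarrow> 'b::real_normed_vector"
  assumes "cc_ball h" "continuous_on poincare_ball f"
  shows "cc_ball (\<lambda>x. h x *\<^sub>R f x)"
  by (rule cc_ball_vanish[OF assms(1)]) (auto intro!: continuous_intros assms cc_ball_continuous[OF assms(1)])

lemma cc_ball_powr:
  fixes f :: "real ^ 'n \<Rightarrow> real"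
  assumes "cc_ball f" "0 < a"
  shows "cc_ball (\<lambda>x. \<bar>f x\<bar> powr a)"
  using assms
  by (intro cc_ball_vanish[OF assms(1)] continuous_on_powr') (auto intro!: continuous_intros simp: cc_ball_continuous)

lemma cc_ball_abs:
  fixes f :: "real ^ 'n \<Rightarrow> real"
  assumes "cc_ball f"
  shows "cc_ball (\<lambda>x. \<bar>f x\<bar>)"
  by (rule cc_ball_vanish[OF assms(1)]) (auto intro!: continuous_intros assms cc_ball_continuous[OF assms(1)])

lemma cc_ball_integrable_lborel:
  fixes f :: "real ^ 'n \<Rightarrow> real"
  assumes "cc_ball f" shows "integrable lborel f"
proof -
  obtain K where K: "compact K" "\<And>x. x \<notin> K \<Longrightarrow> f x = 0"
    using assms by (auto simp: cc_ball_def)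
  have "integrable lborel (\<lambda>x. indicator K x *\<^sub>R f x)"
    using K assms by (intro borel_integrable_compact) (auto simp: cc_ball_continuous)
  also have "(\<lambda>x. indicator K x *\<^sub>R f x) = f"
    using K by (auto simp: fun_eq_iff indicator_def)
  finally show ?thesis .
qed

lemma C1c_ball_cc:
  assumes "C1c_ball f g" shows "cc_ball f" "cc_ball g"
proof -
  obtain K where K: "compact K" "K \<subseteq> poincare_ball" "\<And>x. x \<notin> K \<Longrightarrow> f x = 0"
    and f: "\<And>x. GDERIV f x :> g x" and g: "continuous_on UNIV g"
    using assms by (auto simp: C1c_ball_def)
  have "continuous_on UNIV f"
    using f by (auto simp: gderiv_def intro!: has_derivative_continuous continuous_at_imp_continuous_on)
  then show "cc_ball f"
    using K by (auto simp: cc_ball_def)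
  have "g x = 0" if "x \<notin> K" for x
  proof -
    have "open (- K)"
      using K by (simp add: compact_imp_closed open_Compl)
    have "GDERIV f x :> 0"
      unfolding gderiv_def
      by (rule has_derivative_transform_within_open[where f="\<lambda>x. 0" and s="- K"])
         (use K(3) that \<open>open (- K)\<close> in simp_all)
    then show ?thesis
      using f gderiv_unique by blast
  qed
  then show "cc_ball g"
    using K g by (auto simp: cc_ball_def)
qed

lemma C1c_ballI:
  assumes K: "compact K" "K \<subseteq> poincare_ball" "\<And>x. x \<notin> K \<Longrightarrow> f x = 0" "\<And>x. x \<notin> K \<Longrightarrow> g x = 0"
    and f: "\<And>x. x \<in> poincare_ball \<Longrightarrow> GDERIV f x :> g x" and g: "continuous_on poincare_ball g"
  shows "C1c_ball f g"
proof -
  have "open (- K)"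
    using K by (simp add: compact_imp_closed open_Compl)
  have "GDERIV f x :> g x" for x
  proof (cases "x \<in> poincare_ball")
    case False
    then have "x \<in> - K"
      using K by auto
    have "GDERIV f x :> 0"
      unfolding gderiv_def
      by (rule has_derivative_transform_within_open[where f="\<lambda>x. 0" and s="- K"])
         (use K(3) \<open>open (- K)\<close> \<open>x \<in> - K\<close> in simp_all)
    then show ?thesis
      using K \<open>x \<in> - K\<close> by simp
  qed (use f in auto)
  moreover have "continuous_on UNIV g"
    by (rule continuous_on_cc_glue[OF open_ball K(1,2) g K(4)])
  ultimately show ?thesis
    using K by (auto simp: C1c_ball_def)
qed

lemma C1c_ball_support:
  assumes "C1c_ball f g"
  obtains K where "compact K" "K \<subseteq> poincare_ball" "\<And>x. x \<notin> K \<Longrightarrow> f x = 0" "\<And>x. x \<notin> K \<Longrightarrow> g x = 0"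
proof -
  obtain K L where "compact K" "K \<subseteq> poincare_ball" "\<And>x. x \<notin> K \<Longrightarrow> f x = 0"
    "compact L" "L \<subseteq> poincare_ball" "\<And>x. x \<notin> L \<Longrightarrow> g x = 0"
    using C1c_ball_cc[OF assms] by (auto simp: cc_ball_def)
  then show ?thesis
    by (intro that[of "K \<union> L"]) auto
qed

lemma C1c_ball_mult:
  assumes "C1c_ball f g" "\<And>x. x \<in> poincare_ball \<Longrightarrow> GDERIV h x :> k x" "continuous_on poincare_ball k"
  shows "C1c_ball (\<lambda>x. h x * f x) (\<lambda>x. h x *\<^sub>R g x + f x *\<^sub>R k x)"
proof -
  obtain K where K: "compact K" "K \<subseteq> poincare_ball" "\<And>x. x \<notin> K \<Longrightarrow> f x = 0" "\<And>x. x \<notin> K \<Longrightarrow> g x = 0"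
    using C1c_ball_support[OF assms(1)] by blast
  have "continuous_on poincare_ball h"
    using assms(2) by (auto simp: gderiv_def intro!: has_derivative_continuous continuous_at_imp_continuous_on)
  then show ?thesis
    using assms C1c_ball_cc[OF assms(1)]
    by (intro C1c_ballI[OF K(1,2)])
       (auto simp: K C1c_ball_def cc_ball_continuous intro!: continuous_intros GDERIV_mult)
qed

lemma C1c_ball_chain:
  assumes "C1c_ball f g" "\<And>y. (\<phi> has_real_derivative \<phi>' y) (at y)" "continuous_on UNIV \<phi>'" "\<phi> 0 = 0"
  shows "C1c_ball (\<lambda>x. \<phi> (f x)) (\<lambda>x. \<phi>' (f x) *\<^sub>R g x)"
proof -
  obtain K where K: "compact K" "K \<subseteq> poincare_ball" "\<And>x. x \<notin> K \<Longrightarrow> f x = 0" "\<And>x. x \<notin> K \<Longrightarrow> g x = 0"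
    using C1c_ball_support[OF assms(1)] by blast
  show ?thesis
    using assms C1c_ball_cc[OF assms(1)]
    by (intro C1c_ballI[OF K(1,2)])
       (auto simp: K C1c_ball_def cc_ball_continuous simp del: gderiv_deriv
         intro!: continuous_intros GDERIV_DERIV_compose[of f _ _ \<phi>] continuous_on_compose2[OF assms(3)])
qed

section \<open>Continuously differentiable powers of the absolute value\<close>

lemma DERIV_abs_powr:
  assumes "1 < t"
  shows "((\<lambda>y::real. \<bar>y\<bar> powr t) has_real_derivative t * (sgn y * \<bar>y\<bar> powr (t - 1))) (at y)"
proof -
  consider "0 < y" | "y < 0" | "y = 0"
    by linarith
  then show ?thesis
  proof cases
    case 1
    have "((\<lambda>y. y powr t) has_real_derivative t * y powr (t - 1)) (at y)"
      using 1 by (auto intro!: derivative_eq_intros)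
    then have "((\<lambda>y. \<bar>y\<bar> powr t) has_real_derivative t * y powr (t - 1)) (at y)"
      by (rule has_field_derivative_transform_within_open[of _ _ _ "{0<..}"]) (use 1 in auto)
    then show ?thesis
      using 1 by simp
  next
    case 2
    have "((\<lambda>y. (- y) powr t) has_real_derivative - (t * (- y) powr (t - 1))) (at y)"
      using 2 by (auto intro!: derivative_eq_intros)
    then have "((\<lambda>y. \<bar>y\<bar> powr t) has_real_derivative - (t * (- y) powr (t - 1))) (at y)"
      by (rule has_field_derivative_transform_within_open[of _ _ _ "{..<0}"]) (use 2 in auto)
    then show ?thesis
      using 2 by simp
  next
    case 3
    have "((\<lambda>h::real. \<bar>h\<bar> powr t / h) \<longlongrightarrow> 0) (at 0)"
    proof (rule Lim_null_comparison)
      show "eventually (\<lambda>h. norm (\<bar>h\<bar> powr t / h) \<le> \<bar>h\<bar> powr (t - 1)) (at 0)"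
        by (auto simp: powr_diff eventually_at_filter)
      show "((\<lambda>h::real. \<bar>h\<bar> powr (t - 1)) \<longlongrightarrow> 0) (at 0)"
        using assms by (auto intro!: tendsto_eq_intros tendsto_powr')
    qed
    then show ?thesis
      using 3 assms by (simp add: has_field_derivative_iff)
  qed
qed

lemma continuous_on_sgn_powr:
  assumes "0 < t"
  shows "continuous_on UNIV (\<lambda>y::real. sgn y * \<bar>y\<bar> powr t)"
proof -
  have "isCont (\<lambda>y. sgn y * \<bar>y\<bar> powr t) y" for y :: real
  proof (cases "y = 0")
    case True
    have "((\<lambda>y::real. sgn y * \<bar>y\<bar> powr t) \<longlongrightarrow> 0) (at 0)"
    proof (rule Lim_null_comparison)
      show "eventually (\<lambda>h. norm (sgn h * \<bar>h\<bar> powr t) \<le> \<bar>h\<bar> powr t) (at (0::real))"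
        by (auto simp: abs_mult sgn_if)
      show "((\<lambda>h::real. \<bar>h\<bar> powr t) \<longlongrightarrow> 0) (at 0)"
        using assms by (auto intro!: tendsto_eq_intros tendsto_powr')
    qed
    then show ?thesis
      using True by (simp add: isCont_def)
  qed (auto intro!: continuous_intros)
  then show ?thesis
    by (simp add: continuous_at_imp_continuous_on)
qed

text \<open>This provides the test function f |f|^(s-2). The extra factor y makes the difference
  quotient at 0 equal to |h|^t, so that t > 0 suffices.\<close>

lemma DERIV_sgn_abs_powr:
  assumes "0 < t"
  shows "((\<lambda>y::real. y * \<bar>y\<bar> powr t) has_real_derivative (t + 1) * \<bar>y\<bar> powr t) (at y)"
proof (cases "y = 0")
  case True
  have "((\<lambda>h::real. \<bar>h\<bar> powr t) \<longlongrightarrow> 0) (at 0)"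
    using assms by (auto intro!: tendsto_eq_intros tendsto_powr')
  then have "((\<lambda>h::real. h * \<bar>h\<bar> powr t / h) \<longlongrightarrow> 0) (at 0)"
    by (rule Lim_transform_eventually) (auto simp: eventually_at_filter)
  then show ?thesis
    using True assms by (simp add: has_field_derivative_iff)
next
  case False
  have abs_deriv: "((\<lambda>y. \<bar>y\<bar>) has_real_derivative sgn y) (at y)"
  proof (cases "0 < y")
    case True
    show ?thesis
      by (rule has_field_derivative_transform_within_open[of "\<lambda>y. y" _ _ "{0<..}"]) (use True in auto)
  next
    case neg: False
    show ?thesis
      by (rule has_field_derivative_transform_within_open[of "\<lambda>y. - y" _ _ "{..<0}"])
        (use False neg in \<open>auto intro!: derivative_eq_intros\<close>)
  qed
  have "((\<lambda>y. \<bar>y\<bar> powr t) has_real_derivative t * \<bar>y\<bar> powr (t - 1) * sgn y) (at y)"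
    using DERIV_fun_powr[OF abs_deriv, of t] False by simp
  from DERIV_mult[OF DERIV_ident this]
  have "((\<lambda>y::real. y * \<bar>y\<bar> powr t) has_real_derivative
      y * (t * \<bar>y\<bar> powr (t - 1) * sgn y) + \<bar>y\<bar> powr t) (at y)"
    by (simp add: mult.commute add.commute)
  moreover have "y * (t * \<bar>y\<bar> powr (t - 1) * sgn y) = t * \<bar>y\<bar> powr t"
    using False by (simp add: powr_diff sgn_if)
  ultimately show ?thesis
    using assms by (auto simp: algebra_simps)
qed

section \<open>Vanishing of the integral of a gradient\<close>

lemma lborel_integrable_translate:
  fixes f :: "'a::euclidean_space \<Rightarrow> real"
  assumes "integrable lborel f"
  shows "integrable lborel (\<lambda>x. f (x + a))"
proof -
  have "integrable (distr lborel borel ((+) a)) f"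
    using assms by (simp add: lborel_distr_plus)
  then show ?thesis
    by (subst (asm) integrable_distr_eq) (use assms in \<open>auto simp: add.commute\<close>)
qed

lemma lborel_integral_translate:
  fixes f :: "'a::euclidean_space \<Rightarrow> real"
  assumes [measurable]: "f \<in> borel_measurable borel"
  shows "(\<integral>x. f (x + a) \<partial>lborel) = (\<integral>x. f x \<partial>lborel)"
proof -
  have "(\<integral>x. f x \<partial>lborel) = (\<integral>x. f x \<partial>(distr lborel borel ((+) a)))"
    by (simp add: lborel_distr_plus)
  also have "\<dots> = (\<integral>x. f (x + a) \<partial>lborel)"
    by (subst integral_distr) (auto simp: add.commute)
  finally show ?thesis ..
qed

text \<open>The integral of every difference quotient of f vanishes because Lebesgue measure is
  translation invariant. Dominated convergence passes this on to the derivative; the gradient is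
  bounded, so the mean value inequality supplies the majorant.\<close>

lemma integral_gradient_eq_0:
  assumes "C1c_ball f g"
  shows "(\<integral>x. g x \<bullet> b \<partial>lborel) = 0"
proof -
  obtain K where K: "compact K" "K \<subseteq> poincare_ball" "\<And>x. x \<notin> K \<Longrightarrow> f x = 0" "\<And>x. x \<notin> K \<Longrightarrow> g x = 0"
    using C1c_ball_support[OF assms(1)] by blast
  have f: "\<And>x. GDERIV f x :> g x" and g: "continuous_on UNIV g"
    using assms by (auto simp: C1c_ball_def)
  have cf: "continuous_on UNIV f"
    using C1c_ball_cc[OF assms] by (simp add: cc_ball_continuous)
  have [measurable]: "f \<in> borel_measurable borel" "g \<in> borel_measurable borel"
    using cf g by (auto intro: borel_measurable_continuous_onI)
  obtain B where B: "\<And>x. norm (g x) \<le> B"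
  proof -
    have "compact (g ` K)"
      using K g by (intro compact_continuous_image) (auto intro: continuous_on_subset)
    then obtain B where "\<And>x. x \<in> K \<Longrightarrow> norm (g x) \<le> B"
      using compact_imp_bounded by (force simp: bounded_iff)
    then have "norm (g x) \<le> max B 0" for x
      using K by (cases "x \<in> K") (auto simp: le_max_iff_disj)
    then show ?thesis
      using that by blast
  qed
  define h where "h k = inverse (real (Suc k))" for k
  have h: "0 < h k" "h k \<le> 1" for k
    by (auto simp: h_def field_simps)
  define s where "s k x = (f (x + h k *\<^sub>R b) - f x) / h k" for k x
  \<comment> \<open>The increments \<open>h k\<close> are at most 1, so a point outside this radius
    stays outside the unit ball after the shift, and all difference quotients vanish there.\<close>
  define R where "R = 1 + norm b"
  have lim: "(\<lambda>k. s k x) \<longlonglongrightarrow> g x \<bullet> b" for x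
  proof -
    have "((\<lambda>t. f (x + t *\<^sub>R b)) has_derivative (\<lambda>t. (t *\<^sub>R b) \<bullet> g x)) (at 0)"
      by (rule has_derivative_compose[where f="\<lambda>t. x + t *\<^sub>R b"])
         (auto intro!: derivative_eq_intros f[unfolded gderiv_def, THEN has_derivative_eq_rhs])
    then have "((\<lambda>t. f (x + t *\<^sub>R b)) has_real_derivative g x \<bullet> b) (at 0)"
      by (simp add: has_field_derivative_def inner_commute mult_commute_abs)
    then have "((\<lambda>t. (f (x + t *\<^sub>R b) - f x) / t) \<longlongrightarrow> g x \<bullet> b) (at 0)"
      by (simp add: has_field_derivative_iff)
    moreover have "filterlim h (at 0) sequentially"
      unfolding h_def filterlim_at using LIMSEQ_inverse_real_of_nat by auto
    ultimately show ?thesis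
      unfolding s_def by (rule filterlim_compose)
  qed
  have bound: "norm (s k x) \<le> indicator (cball 0 R) x *\<^sub>R (B * norm b)" for k x
  proof (cases "x \<in> cball 0 R")
    case True
    have "norm (f (x + h k *\<^sub>R b) - f x) \<le> B * norm (x + h k *\<^sub>R b - x)"
    proof (rule differentiable_bound[where S=UNIV and f'="\<lambda>x h. h \<bullet> g x"])
      show "onorm (\<lambda>h. h \<bullet> g x) \<le> B" for x
        using B[of x] by (intro onorm_le) (metis inner_commute mult.commute Cauchy_Schwarz_ineq2 mult_right_mono norm_ge_zero order_trans real_norm_def)
    qed (use f in \<open>auto simp: gderiv_def\<close>)
    then show ?thesis
      using True h(1)[of k] by (simp add: s_def divide_le_eq mult_ac)
  next
    case False
    then have "x \<notin> K" "x + h k *\<^sub>R b \<notin> K"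
    proof -
      have "norm (h k *\<^sub>R b) \<le> norm b"
        using h[of k] by (simp add: mult_left_le_one_le)
      moreover have "norm x \<le> norm (x + h k *\<^sub>R b) + norm (h k *\<^sub>R b)"
        using norm_triangle_ineq4[of "x + h k *\<^sub>R b" "h k *\<^sub>R b"] by simp
      moreover have "norm x > 1 + norm b"
        using False by (simp add: R_def)
      moreover have "0 \<le> norm b"
        by simp
      ultimately have "norm (x + h k *\<^sub>R b) \<ge> 1" "norm x \<ge> 1"
        by linarith+
      then show "x \<notin> K" "x + h k *\<^sub>R b \<notin> K"
        using K(2) by auto
    qed
    moreover have "indicator (cball 0 R) x = (0::real)"
      using False by (simp add: indicator_def)
    ultimately show ?thesis
      using K by (simp add: s_def)
  qed
  have "(\<lambda>k. \<integral>x. s k x \<partial>lborel) \<longlonglongrightarrow> (\<integral>x. g x \<bullet> b \<partial>lborel)"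
  proof (rule integral_dominated_convergence)
    show "integrable lborel (\<lambda>x. indicator (cball 0 R) x *\<^sub>R (B * norm b))"
      by (rule borel_integrable_compact) auto
  qed (use lim bound in \<open>auto simp: s_def\<close>)
  moreover have "(\<integral>x. s k x \<partial>lborel) = 0" for k
  proof -
    have "integrable lborel f"
      using C1c_ball_cc[OF assms] by (simp add: cc_ball_integrable_lborel)
    then have "integrable lborel (\<lambda>x. f (x + h k *\<^sub>R b))"
      by (rule lborel_integrable_translate)
    then show ?thesis
      using \<open>integrable lborel f\<close> by (simp add: s_def lborel_integral_translate)
  qed
  ultimately show ?thesis
    by (simp add: LIMSEQ_const_iff)
qed

section \<open>Integration in the ball model\<close>

text \<open>The inverse of the conformal factor: on the ball the metric is rho^(-2) |dx|^2, the
  volume element rho^(-n) dx, and the squared hyperbolic length of the gradient is rho^2 |grad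
  w|^2.\<close>

definition rho :: "real ^ 'n \<Rightarrow> real" where
  "rho x = (1 - (norm x)\<^sup>2) / 2"

lemma rho_pos: "x \<in> poincare_ball \<Longrightarrow> 0 < rho x"
  by (simp add: rho_def power_less_one_iff abs_square_less_1)

lemma rho_le: "rho x \<le> 1 / 2"
  by (simp add: rho_def)

lemma inner_eq_rho: "x \<bullet> x = 1 - 2 * rho x"
  by (simp add: rho_def power2_norm_eq_inner field_simps)

lemma GDERIV_rho: "GDERIV rho x :> - x"
  unfolding gderiv_def rho_def power2_norm_eq_inner
  by (auto intro!: derivative_eq_intros simp: inner_commute)

lemma continuous_on_rho [continuous_intros]: "continuous_on S rho"
  unfolding rho_def by (intro continuous_intros) auto

lemma continuous_on_rho_powr [continuous_intros]:
  "S \<subseteq> poincare_ball \<Longrightarrow> continuous_on S (\<lambda>x. rho x powr a)"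
  by (intro continuous_intros) (use rho_pos in force)

lemma GDERIV_rho_powr:
  assumes "x \<in> poincare_ball"
  shows "GDERIV (\<lambda>x. rho x powr a) x :> (- a * rho x powr (a - 1)) *\<^sub>R x"
proof -
  have "((\<lambda>y. y powr a) has_real_derivative a * rho x powr (a - 1)) (at (rho x))"
    using rho_pos[OF assms] by (auto intro!: derivative_eq_intros)
  from GDERIV_DERIV_compose[OF GDERIV_rho this] show ?thesis
    by simp
qed

lemma
  fixes f :: "real ^ 'n \<Rightarrow> real"
  assumes "cc_ball f"
  shows integrable_hyp_volume: "integrable hyp_volume f"
    and integral_hyp_volume:
      "(\<integral>x. f x \<partial>hyp_volume) = (\<integral>x. rho x powr (- real CARD('n)) * f x \<partial>lborel)"
proof -
  have [measurable]: "f \<in> borel_measurable borel"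
    using assms by (intro borel_measurable_continuous_onI cc_ball_continuous)
  let ?w = "\<lambda>x::real ^ 'n. (2 / (1 - (norm x)\<^sup>2)) ^ CARD('n)"
  let ?g = "\<lambda>x. rho x powr (- real CARD('n)) * f x"
  have w: "?w x = rho x powr (- real CARD('n))" if "x \<in> poincare_ball" for x
    using rho_pos[OF that] by (simp add: rho_def powr_minus powr_realpow power_divide)
  have eq: "indicator poincare_ball x *\<^sub>R (?w x *\<^sub>R f x) = ?g x" for x
    using w cc_ball_outside[OF assms] by (cases "x \<in> poincare_ball") auto
  have nonneg: "AE x in restrict_space lborel poincare_ball. 0 \<le> ?w x"
    by (subst AE_restrict_space_iff) (auto simp: w simp del: power_divide)
  have f_meas: "f \<in> borel_measurable (restrict_space lborel poincare_ball)"
    by (rule measurable_restrict_space1) measurable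
  have w_meas: "?w \<in> borel_measurable (restrict_space lborel poincare_ball)"
    by (rule measurable_restrict_space1) measurable
  have "integrable hyp_volume f \<longleftrightarrow> integrable (restrict_space lborel poincare_ball) (\<lambda>x. ?w x *\<^sub>R f x)"
    unfolding hyp_volume_def by (rule integrable_density[OF f_meas w_meas nonneg])
  also have "\<dots> \<longleftrightarrow> integrable lborel (\<lambda>x. indicator poincare_ball x *\<^sub>R (?w x *\<^sub>R f x))"
    by (rule integrable_restrict_space) auto
  also have "\<dots> \<longleftrightarrow> integrable lborel ?g"
    by (simp only: eq)
  also have "\<dots>"
    by (intro cc_ball_integrable_lborel cc_ball_mult assms continuous_intros) auto
  finally show "integrable hyp_volume f"
    by simp
  have "(\<integral>x. f x \<partial>hyp_volume) = (\<integral>x. ?w x *\<^sub>R f x \<partial>restrict_space lborel poincare_ball)"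
    unfolding hyp_volume_def by (rule integral_density[OF f_meas w_meas nonneg])
  also have "\<dots> = (\<integral>x. indicator poincare_ball x *\<^sub>R (?w x *\<^sub>R f x) \<partial>lborel)"
    by (rule integral_restrict_space) auto
  finally show "(\<integral>x. f x \<partial>hyp_volume) = (\<integral>x. ?g x \<partial>lborel)"
    by (simp only: eq)
qed

section \<open>Hoelder's inequality and interpolation of integrals\<close>

lemma Holder_inequality:
  fixes f g :: "'a \<Rightarrow> real"
  assumes p: "1 < p" "1 < q" "1 / p + 1 / q = 1"
    and int: "integrable M (\<lambda>x. \<bar>f x\<bar> powr p)" "integrable M (\<lambda>x. \<bar>g x\<bar> powr q)"
      "integrable M (\<lambda>x. \<bar>f x\<bar> * \<bar>g x\<bar>)"
  shows "(\<integral>x. \<bar>f x\<bar> * \<bar>g x\<bar> \<partial>M)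
    \<le> (\<integral>x. \<bar>f x\<bar> powr p \<partial>M) powr (1 / p) * (\<integral>x. \<bar>g x\<bar> powr q \<partial>M) powr (1 / q)"
proof -
  let ?A = "\<integral>x. \<bar>f x\<bar> powr p \<partial>M" and ?B = "\<integral>x. \<bar>g x\<bar> powr q \<partial>M"
  have nonneg: "0 \<le> ?A" "0 \<le> ?B"
    by (auto intro!: integral_nonneg_AE)
  show ?thesis
  proof (cases "?A = 0 \<or> ?B = 0")
    case True
    then have "(AE x in M. \<bar>f x\<bar> powr p = 0) \<or> (AE x in M. \<bar>g x\<bar> powr q = 0)"
      using int by (auto simp: integral_nonneg_eq_0_iff_AE)
    then have "AE x in M. \<bar>f x\<bar> * \<bar>g x\<bar> = 0"
      by (auto elim: eventually_mono)
    then have "(\<integral>x. \<bar>f x\<bar> * \<bar>g x\<bar> \<partial>M) = (\<integral>x. 0 \<partial>M)"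
      using int by (intro integral_cong_AE) auto
    then show ?thesis
      by simp
  next
    case False
    define a b where "a = ?A powr (1 / p)" and "b = ?B powr (1 / q)"
    have pos: "0 < ?A" "0 < ?B"
      using False nonneg by linarith+
    then have pos': "0 < a" "0 < b"
      by (simp_all add: a_def b_def)
    note pos = pos pos'
    have ab: "a powr p = ?A" "b powr q = ?B"
      using p pos by (auto simp: a_def b_def powr_powr)
    have "(\<integral>x. \<bar>f x\<bar> * \<bar>g x\<bar> \<partial>M) / (a * b) = (\<integral>x. (\<bar>f x\<bar> / a) * (\<bar>g x\<bar> / b) \<partial>M)"
      by simp
    also have "\<dots> \<le> (\<integral>x. \<bar>f x\<bar> powr p / (?A * p) + \<bar>g x\<bar> powr q / (?B * q) \<partial>M)"
    proof (rule integral_mono)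
      fix x
      have "(\<bar>f x\<bar> / a) * (\<bar>g x\<bar> / b) \<le> (\<bar>f x\<bar> / a) powr p / p + (\<bar>g x\<bar> / b) powr q / q"
        using p pos by (intro Youngs_inequality) auto
      also have "\<dots> = \<bar>f x\<bar> powr p / (?A * p) + \<bar>g x\<bar> powr q / (?B * q)"
        using pos by (simp add: powr_divide ab)
      finally show "(\<bar>f x\<bar> / a) * (\<bar>g x\<bar> / b) \<le> \<dots>" .
    qed (use int in auto)
    also have "\<dots> = 1 / p + 1 / q"
      using int pos by simp
    finally have "(\<integral>x. \<bar>f x\<bar> * \<bar>g x\<bar> \<partial>M) / (a * b) \<le> 1"
      using p by simp
    then show ?thesis
      using pos by (simp add: divide_le_eq a_def b_def)
  qed
qed

lemma hyp_volume_Holder: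
  fixes f g :: "real ^ 'n \<Rightarrow> real"
  assumes "cc_ball f" "cc_ball g" "1 < p" "1 < q" "1 / p + 1 / q = 1"
  shows "(\<integral>x. \<bar>f x\<bar> * \<bar>g x\<bar> \<partial>hyp_volume)
    \<le> (\<integral>x. \<bar>f x\<bar> powr p \<partial>hyp_volume) powr (1 / p) * (\<integral>x. \<bar>g x\<bar> powr q \<partial>hyp_volume) powr (1 / q)"
  using assms
  by (intro Holder_inequality integrable_hyp_volume cc_ball_powr cc_ball_mult cc_ball_abs)
     (auto intro!: cc_ball_continuous cc_ball_abs)

text \<open>For y = |f|/N, the larger of y^p0 and y^p1 dominates y^p, according to whether y is
  below or above 1. Adding the two costs the factor 2 and replaces the log-convexity of the L^p
  norms.\<close>

lemma hyp_volume_interpolate: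
  fixes f :: "real ^ 'n \<Rightarrow> real"
  assumes f: "cc_ball f" and p: "0 < p0" "p0 \<le> p" "p \<le> p1" and "0 \<le> N"
    and 0: "(\<integral>x. \<bar>f x\<bar> powr p0 \<partial>hyp_volume) \<le> N powr p0"
    and 1: "(\<integral>x. \<bar>f x\<bar> powr p1 \<partial>hyp_volume) \<le> N powr p1"
  shows "(\<integral>x. \<bar>f x\<bar> powr p \<partial>hyp_volume) \<le> 2 * N powr p"
proof (cases "N = 0")
  case True
  have int: "integrable hyp_volume (\<lambda>x. \<bar>f x\<bar> powr r)" if "0 < r" for r
    using that f by (intro integrable_hyp_volume cc_ball_powr)
  have "0 \<le> (\<integral>x. \<bar>f x\<bar> powr p0 \<partial>hyp_volume)"
    by (auto intro!: integral_nonneg_AE)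
  with 0 True have "(\<integral>x. \<bar>f x\<bar> powr p0 \<partial>hyp_volume) = 0"
    by simp
  then have "AE x in hyp_volume. \<bar>f x\<bar> powr p0 = 0"
    using int[OF p(1)] by (subst (asm) integral_nonneg_eq_0_iff_AE) auto
  then have "(\<integral>x. \<bar>f x\<bar> powr p \<partial>hyp_volume) = (\<integral>x. 0 \<partial>(hyp_volume :: (real ^ 'n) measure))"
    using int[of p] p by (intro integral_cong_AE) (auto elim: eventually_mono)
  then show ?thesis
    using True by simp
next
  case False
  then have N: "0 < N"
    using assms by simp
  have int: "integrable hyp_volume (\<lambda>x. \<bar>f x\<bar> powr r)" if "0 < r" for r
    using that f by (intro integrable_hyp_volume cc_ball_powr)
  have "(\<integral>x. \<bar>f x\<bar> powr p \<partial>hyp_volume)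
    \<le> (\<integral>x. N powr p * (\<bar>f x\<bar> powr p0 / N powr p0 + \<bar>f x\<bar> powr p1 / N powr p1) \<partial>hyp_volume)"
  proof (rule integral_mono)
    fix x
    define y where "y = \<bar>f x\<bar> / N"
    have "y powr p \<le> y powr p0 + y powr p1"
    proof (cases "y \<le> 1")
      case True
      then have "y powr p \<le> y powr p0"
        using N p by (intro powr_mono') (auto simp: y_def)
      then show ?thesis
        by (smt (verit) powr_ge_zero)
    next
      case False
      then have "y powr p \<le> y powr p1"
        using N p by (intro powr_mono) (auto simp: y_def)
      then show ?thesis
        by (smt (verit) powr_ge_zero)
    qed
    then have "N powr p * y powr p \<le> N powr p * (y powr p0 + y powr p1)"
      by (intro mult_left_mono) auto
    then show "\<bar>f x\<bar> powr p \<le> N powr p * (\<bar>f x\<bar> powr p0 / N powr p0 + \<bar>f x\<bar> powr p1 / N powr p1)"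
      using N by (simp add: y_def powr_divide)
  qed (use int p in auto)
  also have "\<dots> = N powr p * ((\<integral>x. \<bar>f x\<bar> powr p0 \<partial>hyp_volume) / N powr p0
      + (\<integral>x. \<bar>f x\<bar> powr p1 \<partial>hyp_volume) / N powr p1)"
    using int p by simp
  also have "\<dots> \<le> N powr p * (1 + 1)"
    using 0 1 N by (intro mult_left_mono add_mono) auto
  finally show ?thesis
    by simp
qed

lemma integral_divergence_eq_0:
  fixes F :: "'n \<Rightarrow> real ^ 'n \<Rightarrow> real"
  assumes "\<And>i. C1c_ball (F i) (G i)"
  shows "(\<integral>x. (\<Sum>i\<in>UNIV. G i x $ i) \<partial>lborel) = 0"
proof -
  have "integrable lborel (\<lambda>x. G i x $ i)" for i
    using C1c_ball_cc(2)[OF assms[of i]]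
    by (intro cc_ball_integrable_lborel cc_ball_component)
  then have "(\<integral>x. (\<Sum>i\<in>UNIV. G i x $ i) \<partial>lborel) = (\<Sum>i\<in>UNIV. \<integral>x. G i x $ i \<partial>lborel)"
    by simp
  moreover have "(\<integral>x. G i x $ i \<partial>lborel) = 0" for i
    using integral_gradient_eq_0[OF assms[of i], of "axis i 1"] by (simp add: inner_axis)
  ultimately show ?thesis
    by simp
qed

lemma GDERIV_nth: "GDERIV (\<lambda>x::real^'n. x $ i) x :> axis i 1"
  unfolding gderiv_def inner_axis by (auto intro!: bounded_linear_imp_has_derivative bounded_linear_vec_nth)

text \<open>The divergence theorem for the vector field rho^(1-n) f x, with grad rho = -x and |x|^2
  = 1 - 2 rho. The term (n-1) f, with no factor rho, is what later lets an integral of f be bounded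
  by integrals that contain the gradient or the weight rho.\<close>

lemma hyp_integral_radial:
  fixes f :: "real ^ 'n \<Rightarrow> real"
  assumes f: "C1c_ball f g"
  defines "n \<equiv> real CARD('n)"
  shows "(\<integral>x. rho x * (g x \<bullet> x) + ((n - 1) - (n - 2) * rho x) * f x \<partial>hyp_volume) = 0"
proof -
  note cc = C1c_ball_cc[OF f]
  let ?k = "\<lambda>i x. rho x powr (1 - n) *\<^sub>R axis i 1 + (x $ i) *\<^sub>R ((- (1 - n) * rho x powr (1 - n - 1)) *\<^sub>R x)"
  let ?h = "\<lambda>i x. rho x powr (1 - n) * x $ i"
  let ?I = "\<lambda>x. rho x * (g x \<bullet> x) + ((n - 1) - (n - 2) * rho x) * f x"
  have "C1c_ball (\<lambda>x. ?h i x * f x) (\<lambda>x. ?h i x *\<^sub>R g x + f x *\<^sub>R ?k i x)" for i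
  proof (rule C1c_ball_mult[OF f])
    show "GDERIV (?h i) x :> ?k i x" if "x \<in> poincare_ball" for x
      using that by (intro GDERIV_mult GDERIV_rho_powr GDERIV_nth)
    show "continuous_on poincare_ball (?k i)"
      by (intro continuous_intros order_refl)
  qed
  from integral_divergence_eq_0[OF this]
  have 0: "(\<integral>x. (\<Sum>i\<in>UNIV. (?h i x *\<^sub>R g x + f x *\<^sub>R ?k i x) $ i) \<partial>lborel) = 0" .
  have eq: "(\<Sum>i\<in>UNIV. (?h i x *\<^sub>R g x + f x *\<^sub>R ?k i x) $ i) = rho x powr (- n) * ?I x" for x
  proof (cases "x \<in> poincare_ball")
    case True
    define r where "r = rho x powr (- n)"
    have r: "rho x powr (1 - n) = rho x * r" "rho x powr (1 - n - 1) = r"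
      using rho_pos[OF True] by (auto simp: r_def powr_diff powr_minus field_simps)
    have xx: "(\<Sum>i\<in>UNIV. x $ i * x $ i) = 1 - 2 * rho x"
      using inner_eq_rho[of x] by (simp add: inner_vec_def)
    have "(\<Sum>i\<in>UNIV. (?h i x *\<^sub>R g x + f x *\<^sub>R ?k i x) $ i)
      = (\<Sum>i\<in>UNIV. rho x * r * (g x $ i * x $ i) + f x * (rho x * r) + f x * ((n - 1) * r) * (x $ i * x $ i))"
      unfolding r by (intro sum.cong) (auto simp: axis_def algebra_simps)
    also have "\<dots> = rho x * r * (g x \<bullet> x) + n * (f x * (rho x * r)) + f x * ((n - 1) * r) * (1 - 2 * rho x)"
      by (simp add: sum.distrib xx inner_vec_def n_def flip: sum_distrib_left)
    also have "\<dots> = r * ?I x"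
      by (simp add: algebra_simps)
    finally show ?thesis
      by (simp add: r_def)
  qed (use cc[THEN cc_ball_outside] in auto)
  have "cc_ball ?I"
    by (intro cc_ball_add cc_ball_mult cc_ball_inner cc continuous_intros)
  then show ?thesis
    using 0 unfolding eq by (subst integral_hyp_volume) (simp_all add: n_def)
qed

section \<open>The first order inequality\<close>

text \<open>The quadratic form <A w, w> after integration by parts. Only first derivatives enter,
  because it will be applied to powers |f|^(s/2), which are merely C^1 at zeros of f.\<close>

definition hyp_energy :: "(real ^ 'n \<Rightarrow> real) \<Rightarrow> (real ^ 'n \<Rightarrow> real ^ 'n) \<Rightarrow> real" where
  "hyp_energy w g = (\<integral>x. (rho x)\<^sup>2 * (g x \<bullet> g x) - (real CARD('n) - 1)\<^sup>2 / 4 * (w x)\<^sup>2 \<partial>hyp_volume)"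

text \<open>On the ball this is rho^((n+1)/2) times the gradient of rho^(-(n-1)/2) w. It comes from
  the ground state substitution with the positive function rho^((n-1)/2), which A maps to (n-1)/2
  rho times itself.\<close>

definition twisted_gradient ::
    "(real ^ 'n \<Rightarrow> real) \<Rightarrow> (real ^ 'n \<Rightarrow> real ^ 'n) \<Rightarrow> real ^ 'n \<Rightarrow> real ^ 'n" where
  "twisted_gradient w g x = rho x *\<^sub>R g x + ((real CARD('n) - 1) / 2 * w x) *\<^sub>R x"

lemma cc_ball_twisted_gradient: "C1c_ball w g \<Longrightarrow> cc_ball (twisted_gradient w g)"
  unfolding twisted_gradient_def
  by (intro cc_ball_add cc_ball_scaleR cc_ball_scaleR' cc_ball_mult C1c_ball_cc continuous_intros)
     (auto intro: C1c_ball_cc)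

lemma cc_ball_square:
  fixes f :: "real ^ 'n \<Rightarrow> real"
  assumes "cc_ball f" shows "cc_ball (\<lambda>x. (f x)\<^sup>2)"
  unfolding power2_eq_square by (intro cc_ball_mult assms cc_ball_continuous)

text \<open>Expanding the square leaves the cross term (n-1) rho w (g \<bullet> x), which
  \<open>hyp_integral_radial\<close> for w^2 removes. With |x|^2 = 1 - 2 rho the remaining multiples
  of w^2 combine to the spectral constant and a nonnegative term with weight rho.\<close>

lemma hyp_energy_twisted:
  fixes w :: "real ^ 'n \<Rightarrow> real"
  assumes wg: "C1c_ball w g"
  defines "n \<equiv> real CARD('n)"
  shows "hyp_energy w g = (\<integral>x. (norm (twisted_gradient w g x))\<^sup>2 \<partial>hyp_volume)
    + (n - 1) / 2 * (\<integral>x. rho x * (w x)\<^sup>2 \<partial>hyp_volume)"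
proof -
  note cc = C1c_ball_cc[OF wg] cc_ball_twisted_gradient[OF wg]
  have sq: "C1c_ball (\<lambda>x. (w x)\<^sup>2) (\<lambda>x. (2 * w x) *\<^sub>R g x)"
    by (rule C1c_ball_chain[OF wg, of "\<lambda>y. y\<^sup>2" "\<lambda>y. 2 * y"])
       (auto intro!: derivative_eq_intros continuous_intros)
  let ?R = "\<lambda>x. rho x * (((2 * w x) *\<^sub>R g x) \<bullet> x) + ((n - 1) - (n - 2) * rho x) * (w x)\<^sup>2"
  have R: "(\<integral>x. ?R x \<partial>hyp_volume) = 0"
    unfolding n_def by (rule hyp_integral_radial[OF sq])
  have ccR: "cc_ball ?R"
    by (intro cc_ball_add cc_ball_mult cc_ball_inner C1c_ball_cc[OF sq] continuous_intros)
  have cc1: "cc_ball (\<lambda>x. (norm (twisted_gradient w g x))\<^sup>2)" "cc_ball (\<lambda>x. rho x * (w x)\<^sup>2)"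
    by (intro cc_ball_square cc_ball_norm cc_ball_mult cc continuous_intros)+
  have "(rho x)\<^sup>2 * (g x \<bullet> g x) - (n - 1)\<^sup>2 / 4 * (w x)\<^sup>2
      = (norm (twisted_gradient w g x))\<^sup>2 + (n - 1) / 2 * (rho x * (w x)\<^sup>2) - (n - 1) / 2 * ?R x" for x
  proof -
    have *: "(norm (r *\<^sub>R a + c *\<^sub>R x))\<^sup>2 = r\<^sup>2 * (a \<bullet> a) + 2 * r * c * (a \<bullet> x) + c\<^sup>2 * (x \<bullet> x)"
      for r c :: real and a
      unfolding power2_norm_eq_inner
      by (simp add: inner_add_left inner_add_right inner_commute power2_eq_square algebra_simps)
    have "(norm (twisted_gradient w g x))\<^sup>2
      = (rho x)\<^sup>2 * (g x \<bullet> g x) + 2 * rho x * ((n - 1) / 2 * w x) * (g x \<bullet> x)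
        + ((n - 1) / 2 * w x)\<^sup>2 * (x \<bullet> x)"
      unfolding twisted_gradient_def * n_def ..
    then show ?thesis
      unfolding inner_eq_rho by (simp add: power2_eq_square field_simps)
  qed
  then have "hyp_energy w g = (\<integral>x. (norm (twisted_gradient w g x))\<^sup>2
      + (n - 1) / 2 * (rho x * (w x)\<^sup>2) - (n - 1) / 2 * ?R x \<partial>hyp_volume)"
    by (simp add: hyp_energy_def n_def)
  also have "\<dots> = (\<integral>x. (norm (twisted_gradient w g x))\<^sup>2 \<partial>hyp_volume)
    + (n - 1) / 2 * (\<integral>x. rho x * (w x)\<^sup>2 \<partial>hyp_volume) - (n - 1) / 2 * (\<integral>x. ?R x \<partial>hyp_volume)"
    using cc1[THEN integrable_hyp_volume] ccR[THEN integrable_hyp_volume] by simp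
  finally show ?thesis
    using R by simp
qed

lemma rho_nonneg_mult: "cc_ball f \<Longrightarrow> 0 \<le> f x \<Longrightarrow> 0 \<le> rho x * (f x :: real)"
  using rho_pos[of x] cc_ball_outside[of f x] by (cases "x \<in> poincare_ball") auto

text \<open>With E the energy, Y = int |w|^q dV and S = (E Y)^(1/2), the integrals of |w|^t and of
  |w|^(t \<sigma>) are bounded by c S and (c S)^\<sigma>. Interpolation yields Y \<le> K (E
  Y)^(q/(q+2)), and cancelling the power of Y gives the claim. The upper bound on q is exactly the
  condition q \<le> t \<sigma>.\<close>

lemma poincare_sobolev:
  fixes q :: real
  assumes dim: "3 \<le> CARD('n)"
  defines "n \<equiv> real CARD('n)"
  assumes q: "2 < q" "q \<le> 2 * n / (n - 2)"
  shows "\<exists>C>0. \<forall>(w :: real ^ 'n \<Rightarrow> real) g. C1c_ball w g \<longrightarrow>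
    (\<integral>x. \<bar>w x\<bar> powr q \<partial>hyp_volume) powr (2 / q) \<le> C * hyp_energy w g"
proof -
  define t where "t = q / 2 + 1"
  \<comment> \<open>The coefficient left in front of |w|^t when the radial identity is rewritten
    with the twisted gradient: t(n-1)/2 from the substitution minus n-1 from the divergence. It is
    positive because q > 2.\<close>
  define a where "a = (n - 1) * (t / 2 - 1)"
  \<comment> \<open>One constant for both integral bounds: the first two summands come from the L^1
    norm of the gradient below, the last from the bound on the integral of |w|^t.\<close>
  define c where "c = t + (n - 1) * (t / 2 + 1) * (n * t / a) + n * t / a"
  define K where "K = 2 * c powr (q / t)"
  define \<sigma> where "\<sigma> = n / (n - 1)"
  have n: "3 \<le> n"
    using dim by (simp add: n_def)
  have t: "2 < t" "2 * (t - 1) = q" "0 < t"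
    using q by (auto simp: t_def)
  have a: "0 < a"
    using n t by (simp add: a_def)
  have c: "0 < c" "n * t / a \<le> c" "t + (n - 1) * (t / 2 + 1) * (n * t / a) \<le> c"
    using n t a by (auto simp: c_def intro!: add_pos_pos add_nonneg_nonneg mult_nonneg_nonneg)
  have \<sigma>: "1 < \<sigma>" "0 < \<sigma>"
    using n by (auto simp: \<sigma>_def)
  have "q \<le> t * \<sigma>"
    using q n by (simp add: t_def \<sigma>_def field_simps)
  have "t \<le> q"
    using q by (simp add: t_def)
  have K: "0 < K"
    using c by (simp add: K_def)
  have "(\<integral>x. \<bar>w x\<bar> powr q \<partial>hyp_volume) powr (2 / q) \<le> K powr ((q + 2) / q) * hyp_energy w g"
    if wg: "C1c_ball w g" for w :: "real ^ 'n \<Rightarrow> real" and g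
  proof -
    note cc = C1c_ball_cc[OF wg] cc_ball_twisted_gradient[OF wg]
    define G where "G x = norm (twisted_gradient w g x)" for x
    define Y where "Y = (\<integral>x. \<bar>w x\<bar> powr q \<partial>hyp_volume)"
    define D1 where "D1 = (\<integral>x. (G x)\<^sup>2 \<partial>hyp_volume)"
    define D2 where "D2 = (\<integral>x. rho x * (w x)\<^sup>2 \<partial>hyp_volume)"
    define E where "E = hyp_energy w g"
    define S where "S = (E * Y) powr (1 / 2)"
    have ccG: "cc_ball G"
      unfolding G_def by (intro cc_ball_norm cc)
    have cct: "cc_ball (\<lambda>x. \<bar>w x\<bar> powr r)" if "0 < r" for r
      using that cc by (intro cc_ball_powr)
    have ccD: "cc_ball (\<lambda>x. rho x * (w x)\<^sup>2)"
      by (intro cc_ball_mult cc_ball_square cc continuous_intros)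
    have D: "0 \<le> D1" "0 \<le> D2" "E = D1 + (n - 1) / 2 * D2"
      using hyp_energy_twisted[OF wg] rho_nonneg_mult[OF cc_ball_square[OF cc(1)]]
      by (auto simp: D1_def D2_def E_def G_def n_def intro!: integral_nonneg_AE)
    have "0 \<le> (n - 1) / 2 * D2"
      using n D by auto
    \<comment> \<open>Since \<open>n\<close> is at least 3, the coefficient of \<open>D2\<close> is
      at least 1, so \<open>E\<close> dominates both parts of the energy separately.\<close>
    moreover have "1 * D2 \<le> (n - 1) / 2 * D2"
      using n D by (intro mult_right_mono) auto
    ultimately have DE: "D1 \<le> E" "D2 \<le> E" "0 \<le> E"
      using D by auto
    have Y: "0 \<le> Y"
      by (auto simp: Y_def intro!: integral_nonneg_AE)
    have half: "\<bar>\<bar>w x\<bar> powr (t - 1)\<bar> powr 2 = \<bar>w x\<bar> powr q" for x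
      using t by (simp add: powr_powr mult.commute)
    have I1: "(\<integral>x. \<bar>w x\<bar> powr (t - 1) * G x \<partial>hyp_volume) \<le> S"
    proof -
      have "(\<integral>x. \<bar>G x\<bar> * \<bar>\<bar>w x\<bar> powr (t - 1)\<bar> \<partial>hyp_volume)
        \<le> (\<integral>x. \<bar>G x\<bar> powr 2 \<partial>hyp_volume) powr (1 / 2)
          * (\<integral>x. \<bar>\<bar>w x\<bar> powr (t - 1)\<bar> powr 2 \<partial>hyp_volume) powr (1 / 2)"
        using t by (intro hyp_volume_Holder ccG cct) auto
      also have "\<dots> = (D1 * Y) powr (1 / 2)"
        unfolding half using D Y by (simp add: D1_def Y_def powr_mult)
      also have "\<dots> \<le> S"
        unfolding S_def using D DE Y by (intro powr_mono2 mult_right_mono) auto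
      finally show ?thesis
        by (simp add: G_def mult.commute)
    qed
    \<comment> \<open>Writing the integrand as (rho |w|) |w|^(t-1), Cauchy-Schwarz leaves rho^2 w^2,
      which rho \<le> 1 reduces to the integrand of \<open>D2\<close>.\<close>
    have I2: "(\<integral>x. rho x * \<bar>w x\<bar> powr t \<partial>hyp_volume) \<le> S"
    proof -
      have cc_rw: "cc_ball (\<lambda>x. rho x * w x)"
        by (intro cc_ball_mult cc continuous_intros)
      have "(\<integral>x. rho x * \<bar>w x\<bar> powr t \<partial>hyp_volume)
        = (\<integral>x. \<bar>rho x * w x\<bar> * \<bar>\<bar>w x\<bar> powr (t - 1)\<bar> \<partial>hyp_volume)"
      proof (intro Bochner_Integration.integral_cong refl)
        fix x
        show "rho x * \<bar>w x\<bar> powr t = \<bar>rho x * w x\<bar> * \<bar>\<bar>w x\<bar> powr (t - 1)\<bar>"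
        proof (cases "w x = 0")
          case False
          then have "0 < rho x"
            using rho_pos[of x] cc_ball_outside[OF cc(1), of x] by blast
          then show ?thesis
            using False by (simp add: abs_mult powr_diff)
        qed simp
      qed
      also have "\<dots> \<le> (\<integral>x. \<bar>rho x * w x\<bar> powr 2 \<partial>hyp_volume) powr (1 / 2)
          * (\<integral>x. \<bar>\<bar>w x\<bar> powr (t - 1)\<bar> powr 2 \<partial>hyp_volume) powr (1 / 2)"
        using t by (intro hyp_volume_Holder cc_rw cct) auto
      also have "\<dots> \<le> D2 powr (1 / 2) * Y powr (1 / 2)"
        unfolding half Y_def
      proof (intro mult_right_mono powr_mono2)
        show "(\<integral>x. \<bar>rho x * w x\<bar> powr 2 \<partial>hyp_volume) \<le> D2"
          unfolding D2_def
        proof (rule integral_mono)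
          fix x
          have "rho x * (rho x * (w x)\<^sup>2) \<le> 1 * (rho x * (w x)\<^sup>2)"
            using rho_le[of x] rho_nonneg_mult[OF cc_ball_square[OF cc(1)], of x]
            by (intro mult_right_mono) auto
          then show "\<bar>rho x * w x\<bar> powr 2 \<le> rho x * (w x)\<^sup>2"
            by (simp add: power2_eq_square mult_ac)
        qed (auto intro!: integrable_hyp_volume cc_ball_powr cc_ball_square cc_rw ccD)
      qed (auto intro!: integral_nonneg_AE)
      also have "\<dots> = (D2 * Y) powr (1 / 2)"
        by (simp add: powr_mult)
      also have "\<dots> \<le> S"
        unfolding S_def using D DE Y by (intro powr_mono2 mult_right_mono) auto
      finally show ?thesis .
    qed
    have wt: "C1c_ball (\<lambda>x. \<bar>w x\<bar> powr t) (\<lambda>x. (t * (sgn (w x) * \<bar>w x\<bar> powr (t - 1))) *\<^sub>R g x)"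
      using t by (intro C1c_ball_chain[OF wg, of "\<lambda>y. \<bar>y\<bar> powr t" "\<lambda>y. t * (sgn y * \<bar>y\<bar> powr (t - 1))"])
        (auto intro!: DERIV_abs_powr continuous_intros continuous_on_sgn_powr)
    have ccwG: "cc_ball (\<lambda>x. \<bar>w x\<bar> powr (t - 1) * G x)"
      using t by (intro cc_ball_mult ccG cc_ball_continuous cct) auto
    have ccrt: "cc_ball (\<lambda>x. rho x * \<bar>w x\<bar> powr t)"
      using t by (intro cc_ball_mult cct continuous_intros) auto
    have powr_t: "\<bar>w x\<bar> powr t = \<bar>w x\<bar> powr (t - 1) * \<bar>w x\<bar>" for x
      using t by (cases "w x = 0") (auto simp: powr_diff)
    have I3: "(\<integral>x. \<bar>w x\<bar> powr t \<partial>hyp_volume) \<le> n * t / a * S"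
    proof -
      let ?R = "\<lambda>x. rho x * (((t * (sgn (w x) * \<bar>w x\<bar> powr (t - 1))) *\<^sub>R g x) \<bullet> x)
        + ((n - 1) - (n - 2) * rho x) * \<bar>w x\<bar> powr t"
      have R: "(\<integral>x. ?R x \<partial>hyp_volume) = 0"
        unfolding n_def by (rule hyp_integral_radial[OF wt])
      have ccR: "cc_ball ?R"
        by (intro cc_ball_add cc_ball_mult cc_ball_inner C1c_ball_cc[OF wt] continuous_intros)
      \<comment> \<open>Substituting rho g = \<open>twisted_gradient w g x\<close> - (n-1)/2 w x in
        the radial integrand makes -a |w|^t its only term containing neither the twisted gradient
        nor a factor rho.\<close>
      have pointwise: "a * \<bar>w x\<bar> powr t
        \<le> t * (\<bar>w x\<bar> powr (t - 1) * G x) + (n - 1) * t * (rho x * \<bar>w x\<bar> powr t) - ?R x" for x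
      proof (cases "x \<in> poincare_ball")
        case True
        define T where "T = t * (sgn (w x) * \<bar>w x\<bar> powr (t - 1)) * (twisted_gradient w g x \<bullet> x)"
        have "\<bar>T\<bar> \<le> t * \<bar>w x\<bar> powr (t - 1) * (G x * norm x)"
          unfolding T_def G_def abs_mult using t
          by (intro mult_mono Cauchy_Schwarz_ineq2 mult_left_mono) (auto simp: abs_mult abs_sgn_eq)
        also have "\<dots> \<le> t * \<bar>w x\<bar> powr (t - 1) * (G x * 1)"
          using t True by (intro mult_left_mono) (auto simp: G_def)
        finally have T: "T \<le> t * (\<bar>w x\<bar> powr (t - 1) * G x)"
          by simp
        have sw: "sgn (w x) * w x = \<bar>w x\<bar>"
          by (simp add: sgn_if)
        have "?R x = T - t * \<bar>w x\<bar> powr (t - 1) * ((n - 1) / 2 * (sgn (w x) * w x) * (x \<bullet> x))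
          + ((n - 1) - (n - 2) * rho x) * \<bar>w x\<bar> powr t"
          by (simp add: T_def twisted_gradient_def n_def inner_add_left algebra_simps)
        also have "\<dots> = T - t * (n - 1) / 2 * (1 - 2 * rho x) * \<bar>w x\<bar> powr t
          + ((n - 1) - (n - 2) * rho x) * \<bar>w x\<bar> powr t"
          unfolding sw inner_eq_rho powr_t by (simp add: algebra_simps)
        finally have R_eq: "?R x = T - t * (n - 1) / 2 * (1 - 2 * rho x) * \<bar>w x\<bar> powr t
          + ((n - 1) - (n - 2) * rho x) * \<bar>w x\<bar> powr t" .
        have "t * (\<bar>w x\<bar> powr (t - 1) * G x) + (n - 1) * t * (rho x * \<bar>w x\<bar> powr t) - ?R x - a * \<bar>w x\<bar> powr t
          = t * (\<bar>w x\<bar> powr (t - 1) * G x) - T + (n - 2) * (rho x * \<bar>w x\<bar> powr t)"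
          unfolding R_eq a_def by (simp add: field_simps)
        moreover have "0 \<le> (n - 2) * (rho x * \<bar>w x\<bar> powr t)"
          using n rho_pos[OF True] by simp
        ultimately show ?thesis
          using T by linarith
      qed (use cc_ball_outside[OF cc(1), of x] t in auto)
      have "a * (\<integral>x. \<bar>w x\<bar> powr t \<partial>hyp_volume) = (\<integral>x. a * \<bar>w x\<bar> powr t \<partial>hyp_volume)"
        by simp
      also have "\<dots> \<le> (\<integral>x. t * (\<bar>w x\<bar> powr (t - 1) * G x)
          + (n - 1) * t * (rho x * \<bar>w x\<bar> powr t) - ?R x \<partial>hyp_volume)"
        using pointwise t ccwG ccrt ccR cct[of t]
        by (intro integral_mono Bochner_Integration.integrable_diff Bochner_Integration.integrable_add
            integrable_mult_right integrable_hyp_volume) auto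
      also have "\<dots> = t * (\<integral>x. \<bar>w x\<bar> powr (t - 1) * G x \<partial>hyp_volume)
          + (n - 1) * t * (\<integral>x. rho x * \<bar>w x\<bar> powr t \<partial>hyp_volume)"
        using R ccwG[THEN integrable_hyp_volume] ccrt[THEN integrable_hyp_volume] ccR[THEN integrable_hyp_volume]
        by simp
      also have "\<dots> \<le> t * S + (n - 1) * t * S"
        using I1 I2 t n by (intro add_mono mult_left_mono) auto
      also have "\<dots> = n * t * S"
        by (simp add: algebra_simps)
      finally show ?thesis
        using a by (simp add: field_simps)
    qed
    have S: "0 \<le> S"
      by (simp add: S_def)
    have I4: "(\<integral>x. \<bar>w x\<bar> powr (t * \<sigma>) \<partial>hyp_volume) \<le> (c * S) powr \<sigma>"
    proof -
      \<comment> \<open>The weight is forced by (1-n) \<sigma> = -n: the Lebesgue integral of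
        |F|^\<sigma> is then the hyperbolic integral of |w|^(t \<sigma>).\<close>
      let ?F = "\<lambda>x. rho x powr (1 - n) * \<bar>w x\<bar> powr t"
      let ?k = "\<lambda>x. (- (1 - n) * rho x powr (1 - n - 1)) *\<^sub>R x"
      let ?g = "\<lambda>x. (t * (sgn (w x) * \<bar>w x\<bar> powr (t - 1))) *\<^sub>R g x"
      let ?G = "\<lambda>x. rho x powr (1 - n) *\<^sub>R ?g x + \<bar>w x\<bar> powr t *\<^sub>R ?k x"
      have F: "C1c_ball ?F ?G"
      proof (rule C1c_ball_mult[OF wt])
        show "GDERIV (\<lambda>x. rho x powr (1 - n)) x :> ?k x" if "x \<in> poincare_ball" for x
          using that by (rule GDERIV_rho_powr)
        show "continuous_on poincare_ball ?k"
          by (intro continuous_intros order_refl)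
      qed
      \<comment> \<open>In the coefficient of |w|^t, the part (n-1) t/2 comes from expressing rho g
        by the twisted gradient, and the part n-1 from differentiating the weight.\<close>
      let ?M = "\<lambda>x. t * (\<bar>w x\<bar> powr (t - 1) * G x) + (n - 1) * (t / 2 + 1) * \<bar>w x\<bar> powr t"
      have ccM: "cc_ball ?M"
        using t by (intro cc_ball_add cc_ball_mult[OF ccwG] cc_ball_mult[OF cct] continuous_intros) auto
      have bound: "\<bar>?G x \<bullet> b\<bar> \<le> rho x powr (- n) * ?M x" if "b \<in> Basis" for x b
      proof (cases "x \<in> poincare_ball")
        case True
        have r: "rho x powr (1 - n) = rho x powr (- n) * rho x" "rho x powr (1 - n - 1) = rho x powr (- n)"
          using rho_pos[OF True] by (auto simp: powr_diff powr_minus field_simps)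
        have "rho x *\<^sub>R g x = twisted_gradient w g x - ((n - 1) / 2 * w x) *\<^sub>R x"
          by (simp add: twisted_gradient_def n_def)
        then have "norm (rho x *\<^sub>R g x) \<le> G x + norm (((n - 1) / 2 * w x) *\<^sub>R x)"
          unfolding G_def by (metis norm_triangle_ineq4)
        also have "norm (((n - 1) / 2 * w x) *\<^sub>R x) \<le> (n - 1) / 2 * \<bar>w x\<bar> * 1"
          using n True by (simp add: abs_mult mult_left_le)
        finally have rg: "norm (rho x *\<^sub>R g x) \<le> G x + (n - 1) / 2 * \<bar>w x\<bar>"
          by simp
        have eq: "?G x = rho x powr (- n) *\<^sub>R ((t * (sgn (w x) * \<bar>w x\<bar> powr (t - 1))) *\<^sub>R (rho x *\<^sub>R g x)
            + ((n - 1) * \<bar>w x\<bar> powr t) *\<^sub>R x)"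
          unfolding r by (simp add: algebra_simps)
        have "\<bar>?G x \<bullet> b\<bar> \<le> norm (?G x)"
          using Basis_le_norm[OF that] by blast
        also have "\<dots> \<le> rho x powr (- n) * (norm ((t * (sgn (w x) * \<bar>w x\<bar> powr (t - 1))) *\<^sub>R (rho x *\<^sub>R g x))
            + norm (((n - 1) * \<bar>w x\<bar> powr t) *\<^sub>R x))"
          unfolding eq norm_scaleR[of "rho x powr (- n)"] by (intro mult_mono norm_triangle_ineq) auto
        also have "\<dots> \<le> rho x powr (- n) * (t * \<bar>w x\<bar> powr (t - 1) * (G x + (n - 1) / 2 * \<bar>w x\<bar>)
            + (n - 1) * \<bar>w x\<bar> powr t * 1)"
        proof (intro mult_left_mono add_mono)
          have "norm ((t * (sgn (w x) * \<bar>w x\<bar> powr (t - 1))) *\<^sub>R (rho x *\<^sub>R g x))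
            = \<bar>t * (sgn (w x) * \<bar>w x\<bar> powr (t - 1))\<bar> * norm (rho x *\<^sub>R g x)"
            by (rule norm_scaleR)
          also have "\<dots> \<le> t * \<bar>w x\<bar> powr (t - 1) * (G x + (n - 1) / 2 * \<bar>w x\<bar>)"
            using t rg by (intro mult_mono) (auto simp: abs_mult abs_sgn_eq)
          finally show "norm ((t * (sgn (w x) * \<bar>w x\<bar> powr (t - 1))) *\<^sub>R (rho x *\<^sub>R g x))
            \<le> t * \<bar>w x\<bar> powr (t - 1) * (G x + (n - 1) / 2 * \<bar>w x\<bar>)" .
          have "norm (((n - 1) * \<bar>w x\<bar> powr t) *\<^sub>R x) = (n - 1) * \<bar>w x\<bar> powr t * norm x"
            using n by (simp add: abs_mult)
          also have "\<dots> \<le> (n - 1) * \<bar>w x\<bar> powr t * 1"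
            using n True by (intro mult_left_mono) auto
          finally show "norm (((n - 1) * \<bar>w x\<bar> powr t) *\<^sub>R x) \<le> (n - 1) * \<bar>w x\<bar> powr t * 1" .
        qed auto
        also have "\<dots> = rho x powr (- n) * ?M x"
          unfolding powr_t by (simp add: field_simps)
        finally show ?thesis .
      qed (use cc_ball_outside[OF cc(1), of x] t in auto)
      have Mint: "(\<integral>x. ?M x \<partial>hyp_volume) \<le> c * S"
      proof -
        have "(\<integral>x. ?M x \<partial>hyp_volume) = t * (\<integral>x. \<bar>w x\<bar> powr (t - 1) * G x \<partial>hyp_volume)
          + (n - 1) * (t / 2 + 1) * (\<integral>x. \<bar>w x\<bar> powr t \<partial>hyp_volume)"
          using ccwG[THEN integrable_hyp_volume] cct[of t, THEN integrable_hyp_volume] t by simp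
        also have "\<dots> \<le> t * S + (n - 1) * (t / 2 + 1) * (n * t / a * S)"
          using I1 I3 t n by (intro add_mono mult_left_mono) auto
        also have "\<dots> = (t + (n - 1) * (t / 2 + 1) * (n * t / a)) * S"
          by (simp add: algebra_simps)
        also have "\<dots> \<le> c * S"
          using c S by (intro mult_right_mono)
        finally show ?thesis .
      qed
      have comp: "(\<integral>\<^sup>+x. ennreal \<bar>?G x \<bullet> b\<bar> \<partial>lborel) \<le> ennreal (c * S)" if "b \<in> Basis" for b
      proof -
        have ccM': "cc_ball (\<lambda>x. rho x powr (- n) * ?M x)"
          by (intro cc_ball_mult[OF ccM] continuous_intros order_refl)
        have "(\<integral>\<^sup>+x. ennreal \<bar>?G x \<bullet> b\<bar> \<partial>lborel) \<le> (\<integral>\<^sup>+x. ennreal (rho x powr (- n) * ?M x) \<partial>lborel)"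
          using bound[OF that] by (intro nn_integral_mono ennreal_leI)
        also have "\<dots> = ennreal (\<integral>x. rho x powr (- n) * ?M x \<partial>lborel)"
          using t n by (intro nn_integral_eq_integral cc_ball_integrable_lborel ccM') (auto simp: G_def)
        also have "(\<integral>x. rho x powr (- n) * ?M x \<partial>lborel) = (\<integral>x. ?M x \<partial>hyp_volume)"
          unfolding n_def by (rule integral_hyp_volume[symmetric]) (use ccM in \<open>simp add: n_def\<close>)
        finally show ?thesis
          using Mint by (meson ennreal_leI order_trans)
      qed
      obtain B where B: "compact B" "\<And>x. x \<notin> B \<Longrightarrow> ?F x = 0"
        using C1c_ball_support[OF F] by metis
      have F_powr: "\<bar>?F x\<bar> powr \<sigma> = rho x powr (- n) * \<bar>w x\<bar> powr (t * \<sigma>)" for x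
      proof -
        have "(1 - n) * \<sigma> = - n"
          using n by (simp add: \<sigma>_def field_simps)
        then show ?thesis
          by (simp add: abs_mult powr_mult powr_powr)
      qed
      have "(\<integral>\<^sup>+x. ennreal (rho x powr (- n) * \<bar>w x\<bar> powr (t * \<sigma>)) \<partial>lborel) \<le> ennreal ((c * S) powr \<sigma>)"
      proof -
        have "(\<integral>\<^sup>+x. ennreal (\<bar>?F x\<bar> powr (real DIM(real ^ 'n) / (real DIM(real ^ 'n) - 1))) \<partial>lborel)
          \<le> ennreal ((c * S) powr (real DIM(real ^ 'n) / (real DIM(real ^ 'n) - 1)))"
          by (rule gagliardo_nirenberg[of ?F ?G B])
             (use F B comp S c dim in \<open>auto simp: C1c_ball_def simp del: scaleR_left_diff_distrib\<close>)
        then have "(\<integral>\<^sup>+x. ennreal (\<bar>?F x\<bar> powr \<sigma>) \<partial>lborel) \<le> ennreal ((c * S) powr \<sigma>)"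
          by (simp add: \<sigma>_def n_def)
        then show ?thesis
          by (simp only: F_powr)
      qed
      also have "(\<integral>\<^sup>+x. ennreal (rho x powr (- n) * \<bar>w x\<bar> powr (t * \<sigma>)) \<partial>lborel)
        = ennreal (\<integral>x. rho x powr (- n) * \<bar>w x\<bar> powr (t * \<sigma>) \<partial>lborel)"
        using t \<sigma> by (intro nn_integral_eq_integral cc_ball_integrable_lborel cc_ball_mult cct continuous_intros) auto
      also have "(\<integral>x. rho x powr (- n) * \<bar>w x\<bar> powr (t * \<sigma>) \<partial>lborel) = (\<integral>x. \<bar>w x\<bar> powr (t * \<sigma>) \<partial>hyp_volume)"
        unfolding n_def using t \<sigma> by (intro integral_hyp_volume[symmetric] cct) auto
      finally show ?thesis
        by (simp add: ennreal_le_iff)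
    qed
    \<comment> \<open>The bounds c S and (c S)^\<sigma> are the t-th and (t \<sigma>)-th powers of a
      single number, as interpolation requires.\<close>
    define N where "N = (c * S) powr (1 / t)"
    have N: "N powr t = c * S" "N powr (t * \<sigma>) = (c * S) powr \<sigma>" "N powr q = (c * S) powr (q / t)" "0 \<le> N"
      using c S t by (auto simp: N_def powr_powr)
    have "Y \<le> 2 * N powr q"
      unfolding Y_def
    proof (rule hyp_volume_interpolate[OF cc(1)])
      show "(\<integral>x. \<bar>w x\<bar> powr t \<partial>hyp_volume) \<le> N powr t"
        using I3 c(2) S unfolding N by (meson mult_right_mono order_trans)
      show "(\<integral>x. \<bar>w x\<bar> powr (t * \<sigma>) \<partial>hyp_volume) \<le> N powr (t * \<sigma>)"
        using I4 unfolding N .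
    qed (use t N \<open>q \<le> t * \<sigma>\<close> \<open>t \<le> q\<close> in auto)
    also have "\<dots> = K * (E powr (q / (q + 2)) * Y powr (q / (q + 2)))"
    proof -
      have "2 * t = q + 2"
        by (simp add: t_def)
      then show ?thesis
        unfolding N K_def S_def by (simp add: powr_mult powr_powr)
    qed
    finally have main: "Y \<le> K * (E powr (q / (q + 2)) * Y powr (q / (q + 2)))" .
    show ?thesis
    proof (cases "Y = 0")
      case True
      then show ?thesis
        using K DE(3) unfolding E_def Y_def by simp
    next
      case False
      then have "0 < Y"
        using Y by simp
      \<comment> \<open>The factor Y^(q/(q+2)) is split off to be cancelled; the power (q+2)/q then
        turns Y^(2/(q+2)) into Y^(2/q) and leaves \<open>E\<close> linear.\<close>
      have "Y = Y powr (2 / (q + 2)) * Y powr (q / (q + 2))"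
      proof -
        have "2 / (q + 2) + q / (q + 2) = 1"
          using q by (simp add: add_divide_distrib[symmetric])
        then show ?thesis
          using \<open>0 < Y\<close> by (simp flip: powr_add)
      qed
      then have "Y powr (2 / (q + 2)) * Y powr (q / (q + 2)) \<le> K * E powr (q / (q + 2)) * Y powr (q / (q + 2))"
        using main by (simp add: mult_ac)
      then have "Y powr (2 / (q + 2)) \<le> K * E powr (q / (q + 2))"
        using \<open>0 < Y\<close> by simp
      then have "(Y powr (2 / (q + 2))) powr ((q + 2) / q) \<le> (K * E powr (q / (q + 2))) powr ((q + 2) / q)"
        using q by (intro powr_mono2) auto
      also have "\<dots> = K powr ((q + 2) / q) * E"
        using q DE by (simp add: powr_mult powr_powr)
      also have "(Y powr (2 / (q + 2))) powr ((q + 2) / q) = Y powr (2 / q)"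
      proof -
        have "2 / (q + 2) * ((q + 2) / q) = 2 / q"
          using q by (simp add: divide_simps)
        then show ?thesis
          by (simp only: powr_powr)
      qed
      finally show ?thesis
        by (simp add: Y_def E_def)
    qed
  qed
  moreover have "0 < K powr ((q + 2) / q)"
    using K by simp
  ultimately show ?thesis
    by blast
qed

section \<open>Gradients assembled from partial derivatives\<close>

lemma partial_deriv_GDERIV:
  assumes "GDERIV f x :> D"
  shows "partial_deriv i f x = D $ i"
  unfolding partial_deriv_def frechet_derivative_at[OF assms[unfolded gderiv_def], symmetric]
  by (simp add: inner_axis')

definition grad :: "(real ^ 'n \<Rightarrow> real) \<Rightarrow> real ^ 'n \<Rightarrow> real ^ 'n" where
  "grad f x = (\<chi> i. partial_deriv i f x)"

lemma grad_nth [simp]: "grad f x $ i = partial_deriv i f x"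
  by (simp add: grad_def)

lemma GDERIV_grad:
  assumes "f differentiable at x"
  shows "GDERIV f x :> grad f x"
proof -
  let ?D = "frechet_derivative f (at x)"
  have D: "(f has_derivative ?D) (at x)"
    using assms by (simp add: frechet_derivative_works)
  then interpret bounded_linear ?D
    by (rule has_derivative_bounded_linear)
  have "?D h = h \<bullet> grad f x" for h
  proof -
    have "?D h = ?D (\<Sum>i\<in>UNIV. (h $ i) *\<^sub>R axis i 1)"
      by (metis basis_expansion scalar_mult_eq_scaleR)
    also have "\<dots> = (\<Sum>i\<in>UNIV. (h $ i) * ?D (axis i 1))"
      by (simp add: sum scaleR)
    finally show ?thesis
      by (simp add: inner_vec_def partial_deriv_def)
  qed
  then have "?D = (\<lambda>h. h \<bullet> grad f x)"
    by (rule ext)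
  then show ?thesis
    using D by (simp only: gderiv_def)
qed

section \<open>Smooth functions\<close>

lemma partial_deriv_cong:
  assumes "open S" "\<And>x. x \<in> S \<Longrightarrow> f x = g x" "x \<in> S"
  shows "partial_deriv i f x = partial_deriv i g x" "f differentiable (at x) \<longleftrightarrow> g differentiable (at x)"
proof -
  have "(f has_derivative D) (at x) \<longleftrightarrow> (g has_derivative D) (at x)" for D
    using has_derivative_transform_within_open[of f D x UNIV S g]
      has_derivative_transform_within_open[of g D x UNIV S f] assms by auto
  then show "partial_deriv i f x = partial_deriv i g x" "f differentiable (at x) \<longleftrightarrow> g differentiable (at x)"
    by (simp_all add: partial_deriv_def frechet_derivative_def differentiable_def)
qed

lemma Ck_on_cong:
  assumes "open S" "\<And>x. x \<in> S \<Longrightarrow> f x = g x"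
  shows "Ck_on m S f \<longleftrightarrow> Ck_on m S g"
  using assms(2)
proof (induction m arbitrary: f g)
  case 0
  then show ?case
    by (simp cong: continuous_on_cong)
next
  case (Suc m)
  have "Ck_on m S (partial_deriv i f) \<longleftrightarrow> Ck_on m S (partial_deriv i g)" for i
    using partial_deriv_cong(1)[OF assms(1) Suc.prems] by (intro Suc.IH) auto
  then show ?case
    using partial_deriv_cong(2)[OF assms(1) Suc.prems] by auto
qed

lemma Ck_on_Un:
  assumes "open S" "open T" "Ck_on m S f" "Ck_on m T f"
  shows "Ck_on m (S \<union> T) f"
  using assms(3,4)
proof (induction m arbitrary: f)
  case 0
  then show ?case
    using assms(1,2) by (simp add: continuous_on_open_Un)
qed auto

lemma Ck_on_const: "Ck_on m S (\<lambda>x. c)"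
proof (induction m arbitrary: c)
  case (Suc m)
  have "partial_deriv i (\<lambda>x. c) = (\<lambda>x::real^'a. 0)" for i
    using partial_deriv_GDERIV[OF GDERIV_const] by (auto simp: fun_eq_iff)
  then show ?case
    using Suc by simp
qed simp

lemma Ck_on_Suc_imp: "Ck_on (Suc m) S f \<Longrightarrow> Ck_on m S f"
proof (induction m arbitrary: f)
  case 0
  then show ?case
    by (auto intro!: continuous_at_imp_continuous_on differentiable_imp_continuous_within)
qed auto

lemma Ck_on_add:
  assumes "Ck_on m UNIV f" "Ck_on m UNIV g"
  shows "Ck_on m UNIV (\<lambda>x. f x + g x)"
  using assms
proof (induction m arbitrary: f g)
  case 0
  then show ?case
    by (auto intro: continuous_intros)
next
  case (Suc m)
  have "partial_deriv i (\<lambda>x. f x + g x) = (\<lambda>x. partial_deriv i f x + partial_deriv i g x)" for i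
    using Suc.prems by (intro ext) (auto simp: partial_deriv_GDERIV[OF GDERIV_add[OF GDERIV_grad GDERIV_grad]])
  then show ?case
    using Suc by simp
qed

lemma Ck_on_mult:
  assumes "Ck_on m UNIV f" "Ck_on m UNIV g"
  shows "Ck_on m UNIV (\<lambda>x. f x * g x)"
  using assms
proof (induction m arbitrary: f g)
  case 0
  then show ?case
    by (auto intro: continuous_intros)
next
  case (Suc m)
  have "partial_deriv i (\<lambda>x. f x * g x) = (\<lambda>x. f x * partial_deriv i g x + g x * partial_deriv i f x)" for i
    using Suc.prems by (intro ext) (auto simp: partial_deriv_GDERIV[OF GDERIV_mult[OF GDERIV_grad GDERIV_grad]])
  moreover have "Ck_on m UNIV f" "Ck_on m UNIV g"
    using Suc.prems Ck_on_Suc_imp by blast+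
  ultimately show ?case
    using Suc by (simp add: Ck_on_add)
qed

lemma Ck_on_nth: "Ck_on m S (\<lambda>x. x $ i)"
proof (cases m)
  case (Suc k)
  have "partial_deriv j (\<lambda>x. x $ i) = (\<lambda>x. axis i 1 $ j)" for j :: 'a
    using partial_deriv_GDERIV[OF GDERIV_nth] by (auto simp: fun_eq_iff)
  moreover have "(\<lambda>x::real^'a. x $ i) differentiable at x" for x
    using GDERIV_nth[of i x] by (auto simp: gderiv_def differentiable_def)
  ultimately show ?thesis
    using Suc by (simp add: Ck_on_const)
qed (auto intro!: continuous_intros)

lemma smooth_on_const: "smooth_on UNIV (\<lambda>x. c)"
  and smooth_on_nth: "smooth_on UNIV (\<lambda>x. x $ i)"
  by (simp_all add: smooth_on_def Ck_on_const Ck_on_nth)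

lemma smooth_on_add: "smooth_on UNIV f \<Longrightarrow> smooth_on UNIV g \<Longrightarrow> smooth_on UNIV (\<lambda>x. f x + g x)"
  and smooth_on_mult: "smooth_on UNIV f \<Longrightarrow> smooth_on UNIV g \<Longrightarrow> smooth_on UNIV (\<lambda>x. f x * g x)"
  by (simp_all add: smooth_on_def Ck_on_add Ck_on_mult)

lemma smooth_on_sum:
  "finite I \<Longrightarrow> (\<And>i. i \<in> I \<Longrightarrow> smooth_on UNIV (f i)) \<Longrightarrow> smooth_on UNIV (\<lambda>x. \<Sum>i\<in>I. f i x)"
  by (induction I rule: finite_induct) (auto intro: smooth_on_const smooth_on_add)

lemma smooth_on_partial_deriv:
  assumes "smooth_on S f" shows "smooth_on S (partial_deriv i f)"
  unfolding smooth_on_def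
proof
  fix m
  have "Ck_on (Suc m) S f"
    using assms unfolding smooth_on_def by blast
  then show "Ck_on m S (partial_deriv i f)"
    by simp
qed

lemma smooth_on_differentiable:
  assumes "smooth_on S f" "x \<in> S" shows "f differentiable at x"
proof -
  have "Ck_on (Suc 0) S f"
    using assms unfolding smooth_on_def by blast
  then show ?thesis
    using assms(2) by simp
qed

lemma smooth_on_continuous:
  assumes "smooth_on S f" shows "continuous_on S f"
proof -
  have "Ck_on 0 S f"
    using assms unfolding smooth_on_def by blast
  then show ?thesis
    by simp
qed

lemma smooth_on_rho: "smooth_on UNIV rho"
proof -
  have "rho = (\<lambda>x::real^'a. 1 / 2 + (- 1 / 2) * (\<Sum>i\<in>UNIV. x $ i * x $ i))"
    by (auto simp: rho_def power2_norm_eq_inner inner_vec_def field_simps fun_eq_iff)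
  moreover have "smooth_on UNIV (\<lambda>x::real^'a. 1 / 2 + (- 1 / 2) * (\<Sum>i\<in>UNIV. x $ i * x $ i))"
    by (intro smooth_on_const smooth_on_add smooth_on_mult smooth_on_sum smooth_on_nth) auto
  ultimately show ?thesis
    by (simp only:)
qed

text \<open>The class in which test functions are handled after extension by zero. The shifted
  Laplacian has polynomial coefficients and preserves it, so arbitrary iterates can be
  formed.\<close>

definition smooth_cc :: "(real ^ 'n \<Rightarrow> real) \<Rightarrow> bool" where
  "smooth_cc f \<longleftrightarrow> smooth_on UNIV f \<and>
    (\<exists>K. compact K \<and> K \<subseteq> poincare_ball \<and> (\<forall>x. x \<notin> K \<longrightarrow> f x = 0))"

lemma smooth_cc_C1c:
  assumes "smooth_cc f" shows "C1c_ball f (grad f)"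
proof -
  have f: "smooth_on UNIV f"
    using assms by (simp add: smooth_cc_def)
  have "continuous_on UNIV (grad f)"
    unfolding grad_def
    by (intro continuous_on_vec_lambda smooth_on_continuous smooth_on_partial_deriv f)
  then show ?thesis
    using assms smooth_on_differentiable[OF f] by (auto simp: C1c_ball_def smooth_cc_def intro!: GDERIV_grad)
qed

lemma smooth_cc_cc: "smooth_cc f \<Longrightarrow> cc_ball f"
  using smooth_cc_C1c C1c_ball_cc by blast

lemma smooth_ccI: "smooth_on UNIV f \<Longrightarrow> cc_ball f \<Longrightarrow> smooth_cc f"
  by (simp add: smooth_cc_def cc_ball_def)

lemma smooth_cc_smooth: "smooth_cc f \<Longrightarrow> smooth_on UNIV f"
  by (simp add: smooth_cc_def)

lemma smooth_cc_partial_deriv: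
  assumes "smooth_cc f" shows "smooth_cc (partial_deriv i f)"
proof (rule smooth_ccI)
  show "smooth_on UNIV (partial_deriv i f)"
    using assms by (intro smooth_on_partial_deriv smooth_cc_smooth)
  have "cc_ball (\<lambda>x. grad f x $ i)"
    using C1c_ball_cc(2)[OF smooth_cc_C1c[OF assms]] by (rule cc_ball_component)
  then show "cc_ball (partial_deriv i f)"
    by simp
qed

lemma smooth_cc_add:
  assumes "smooth_cc f" "smooth_cc g" shows "smooth_cc (\<lambda>x. f x + g x)"
  by (rule smooth_ccI) (intro smooth_on_add cc_ball_add smooth_cc_smooth smooth_cc_cc assms)+

lemma smooth_cc_mult:
  assumes "smooth_cc f" "smooth_on UNIV h" shows "smooth_cc (\<lambda>x. h x * f x)"
proof (rule smooth_ccI)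
  show "smooth_on UNIV (\<lambda>x. h x * f x)"
    by (intro smooth_on_mult smooth_cc_smooth assms)
  have "continuous_on poincare_ball h"
    using smooth_on_continuous[OF assms(2)] by (rule continuous_on_subset) simp
  then show "cc_ball (\<lambda>x. h x * f x)"
    by (intro cc_ball_mult smooth_cc_cc assms)
qed

lemma smooth_cc_cmult: "smooth_cc f \<Longrightarrow> smooth_cc (\<lambda>x. c * f x)"
  by (intro smooth_cc_mult smooth_on_const)

lemma smooth_cc_sum:
  "finite I \<Longrightarrow> (\<And>i. i \<in> I \<Longrightarrow> smooth_cc (f i)) \<Longrightarrow> smooth_cc (\<lambda>x. \<Sum>i\<in>I. f i x)"
proof (induction I rule: finite_induct)
  case empty
  have "smooth_cc (\<lambda>x. 0)"
    by (auto simp: smooth_cc_def smooth_on_const)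
  then show ?case
    by simp
qed (auto intro: smooth_cc_add)

section \<open>The shifted Laplacian\<close>

definition shifted_laplacian :: "(real ^ 'n \<Rightarrow> real) \<Rightarrow> real ^ 'n \<Rightarrow> real" where
  "shifted_laplacian f x = - hyp_laplacian f x - (real CARD('n) - 1)\<^sup>2 / 4 * f x"

lemma hyp_laplacian_rho:
  "hyp_laplacian (f :: real ^ 'n \<Rightarrow> real) x = (rho x)\<^sup>2 * (\<Sum>i\<in>UNIV. partial_deriv i (partial_deriv i f) x)
    + (real CARD('n) - 2) * rho x * (\<Sum>i\<in>UNIV. x $ i * partial_deriv i f x)"
proof -
  have *: "1 - (norm x)\<^sup>2 = 2 * rho x"
    by (simp add: rho_def)
  show ?thesis
    unfolding hyp_laplacian_def * by (simp add: power2_eq_square algebra_simps)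
qed

lemma smooth_cc_shifted_laplacian:
  assumes "smooth_cc f" shows "smooth_cc (shifted_laplacian f)"
proof -
  have "shifted_laplacian f x = (\<Sum>i\<in>UNIV. (- 1 * (rho x * rho x)) * partial_deriv i (partial_deriv i f) x)
    + ((\<Sum>i\<in>UNIV. (- (real CARD('a) - 2) * rho x * x $ i) * partial_deriv i f x)
       + - ((real CARD('a) - 1)\<^sup>2 / 4) * f x)" for x
    unfolding shifted_laplacian_def hyp_laplacian_rho mult.assoc sum_distrib_left[symmetric]
    by (simp add: power2_eq_square algebra_simps)
  then have "shifted_laplacian f = (\<lambda>x. (\<Sum>i\<in>UNIV. (- 1 * (rho x * rho x)) * partial_deriv i (partial_deriv i f) x)
    + ((\<Sum>i\<in>UNIV. (- (real CARD('a) - 2) * rho x * x $ i) * partial_deriv i f x)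
       + - ((real CARD('a) - 1)\<^sup>2 / 4) * f x))"
    by (rule ext)
  moreover have "smooth_cc (\<lambda>x. (\<Sum>i\<in>UNIV. (- 1 * (rho x * rho x)) * partial_deriv i (partial_deriv i f) x)
    + ((\<Sum>i\<in>UNIV. (- (real CARD('a) - 2) * rho x * x $ i) * partial_deriv i f x)
       + - ((real CARD('a) - 1)\<^sup>2 / 4) * f x))"
    by (intro smooth_cc_add smooth_cc_sum smooth_cc_mult smooth_cc_partial_deriv assms
        smooth_on_mult smooth_on_const smooth_on_rho smooth_on_nth) auto
  ultimately show ?thesis
    by (simp only:)
qed

lemma shifted_laplacian_lin:
  assumes "smooth_cc f" "smooth_cc g"
  shows "shifted_laplacian (\<lambda>x. f x + c * g x) = (\<lambda>x. shifted_laplacian f x + c * shifted_laplacian g x)"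
proof -
  have pd: "partial_deriv i (\<lambda>x. f x + c * g x) = (\<lambda>x. partial_deriv i f x + c * partial_deriv i g x)"
    if "smooth_cc f" "smooth_cc g" for f g :: "real ^ 'a \<Rightarrow> real" and i
  proof
    fix x
    have "GDERIV f x :> grad f x" "GDERIV g x :> grad g x"
      using that smooth_cc_C1c by (auto simp: C1c_ball_def)
    from GDERIV_add[OF this(1) GDERIV_mult[OF GDERIV_const[of c] this(2)]]
    show "partial_deriv i (\<lambda>x. f x + c * g x) x = partial_deriv i f x + c * partial_deriv i g x"
      by (simp add: partial_deriv_GDERIV)
  qed
  have pd2: "partial_deriv i (partial_deriv i (\<lambda>x. f x + c * g x)) x
      = partial_deriv i (partial_deriv i f) x + c * partial_deriv i (partial_deriv i g) x" for i x
    using assms by (simp add: pd smooth_cc_partial_deriv)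
  have pd1: "x $ i * partial_deriv i (\<lambda>x. f x + c * g x) x
      = x $ i * partial_deriv i f x + c * (x $ i * partial_deriv i g x)" for i x
    using assms by (simp add: pd algebra_simps)
  show ?thesis
    unfolding fun_eq_iff shifted_laplacian_def hyp_laplacian_rho pd1 pd2 sum.distrib sum_distrib_left[symmetric]
    by (simp add: algebra_simps)
qed

text \<open>Green's formula, from the divergence theorem for rho^(2-n) \<phi> grad f and the
  identity \<open>hyp_laplacian\<close> f = rho^n div(rho^(2-n) grad f) on the ball. The function
  \<phi> is only C^1, which admits f |f|^(s-2).\<close>

lemma shifted_laplacian_weak:
  fixes f :: "real ^ 'n \<Rightarrow> real"
  assumes f: "smooth_cc f" and \<phi>: "C1c_ball \<phi> g"
  defines "n \<equiv> real CARD('n)"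
  shows "(\<integral>x. shifted_laplacian f x * \<phi> x \<partial>hyp_volume)
    = (\<integral>x. (rho x)\<^sup>2 * (grad f x \<bullet> g x) - (n - 1)\<^sup>2 / 4 * (f x * \<phi> x) \<partial>hyp_volume)"
proof -
  note cc = C1c_ball_cc[OF \<phi>] C1c_ball_cc[OF smooth_cc_C1c[OF f]]
  note cA = smooth_cc_cc[OF smooth_cc_shifted_laplacian[OF f]]
  let ?h = "\<lambda>i x. rho x powr (2 - n) * partial_deriv i f x"
  let ?k = "\<lambda>i x. rho x powr (2 - n) *\<^sub>R grad (partial_deriv i f) x
    + partial_deriv i f x *\<^sub>R ((- (2 - n) * rho x powr (2 - n - 1)) *\<^sub>R x)"
  have "C1c_ball (\<lambda>x. ?h i x * \<phi> x) (\<lambda>x. ?h i x *\<^sub>R g x + \<phi> x *\<^sub>R ?k i x)" for i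
  proof (rule C1c_ball_mult[OF \<phi>])
    have pd: "C1c_ball (partial_deriv i f) (grad (partial_deriv i f))"
      by (intro smooth_cc_C1c smooth_cc_partial_deriv f)
    then show "GDERIV (?h i) x :> ?k i x" if "x \<in> poincare_ball" for x
      using that by (intro GDERIV_mult GDERIV_rho_powr) (auto simp: C1c_ball_def)
    show "continuous_on poincare_ball (?k i)"
      using C1c_ball_cc[OF pd] by (intro continuous_intros order_refl cc_ball_continuous)
  qed
  from integral_divergence_eq_0[OF this]
  have 0: "(\<integral>x. (\<Sum>i\<in>UNIV. (?h i x *\<^sub>R g x + \<phi> x *\<^sub>R ?k i x) $ i) \<partial>lborel) = 0" .
  let ?I = "\<lambda>x. (rho x)\<^sup>2 * (grad f x \<bullet> g x) - (n - 1)\<^sup>2 / 4 * (f x * \<phi> x)"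
  have eq: "(\<Sum>i\<in>UNIV. (?h i x *\<^sub>R g x + \<phi> x *\<^sub>R ?k i x) $ i)
    = rho x powr (- n) * (?I x + - (shifted_laplacian f x * \<phi> x))" for x
  proof (cases "x \<in> poincare_ball")
    case True
    define r where "r = rho x powr (- n)"
    have r: "rho x powr (2 - n) = (rho x)\<^sup>2 * r" "rho x powr (2 - n - 1) = rho x * r"
      using rho_pos[OF True] by (auto simp: r_def powr_diff powr_minus field_simps power2_eq_square)
    have "(\<Sum>i\<in>UNIV. (?h i x *\<^sub>R g x + \<phi> x *\<^sub>R ?k i x) $ i)
      = (\<Sum>i\<in>UNIV. (rho x)\<^sup>2 * r * (partial_deriv i f x * g x $ i)
        + \<phi> x * (rho x)\<^sup>2 * r * partial_deriv i (partial_deriv i f) x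
        + \<phi> x * (n - 2) * rho x * r * (x $ i * partial_deriv i f x))"
      unfolding r by (intro sum.cong) (auto simp: algebra_simps)
    also have "\<dots> = r * ((rho x)\<^sup>2 * (grad f x \<bullet> g x) + \<phi> x * hyp_laplacian f x)"
      unfolding hyp_laplacian_rho sum.distrib sum_distrib_left[symmetric] inner_vec_def grad_nth inner_real_def n_def
      by (simp add: algebra_simps)
    finally show ?thesis
      unfolding r_def shifted_laplacian_def n_def by (simp add: algebra_simps)
  qed (use cc[THEN cc_ball_outside] in auto)
  have ccI: "cc_ball ?I"
    unfolding diff_conv_add_uminus minus_mult_left
    by (intro cc_ball_add cc_ball_mult cc_ball_inner cc cc_ball_continuous[OF cc(1)] cc_ball_continuous[OF cc(2)]
        cc_ball_continuous[OF cc(3)] continuous_intros)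
  have ccA: "cc_ball (\<lambda>x. shifted_laplacian f x * \<phi> x)"
    by (intro cc_ball_mult cc cc_ball_continuous[OF cA])
  have "cc_ball (\<lambda>x. - 1 * (shifted_laplacian f x * \<phi> x))"
    by (intro cc_ball_mult[OF ccA] continuous_intros)
  with ccI have "cc_ball (\<lambda>x. ?I x + - (shifted_laplacian f x * \<phi> x))"
    using cc_ball_add by fastforce
  from integral_hyp_volume[OF this] have "(\<integral>x. ?I x + - (shifted_laplacian f x * \<phi> x) \<partial>hyp_volume) = 0"
    using 0 unfolding eq by (simp add: n_def)
  then show ?thesis
    using integrable_hyp_volume[OF ccI] integrable_hyp_volume[OF ccA] by simp
qed

lemma shifted_laplacian_sym:
  assumes "smooth_cc f" "smooth_cc g"
  shows "(\<integral>x. shifted_laplacian f x * g x \<partial>hyp_volume) = (\<integral>x. f x * shifted_laplacian g x \<partial>hyp_volume)"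
  using shifted_laplacian_weak[OF assms(1) smooth_cc_C1c[OF assms(2)]]
    shifted_laplacian_weak[OF assms(2) smooth_cc_C1c[OF assms(1)]]
  by (simp add: inner_commute mult.commute)

lemma hyp_energy_shifted_laplacian:
  assumes "smooth_cc f"
  shows "hyp_energy f (grad f) = (\<integral>x. shifted_laplacian f x * f x \<partial>hyp_volume)"
  using shifted_laplacian_weak[OF assms smooth_cc_C1c[OF assms]]
  by (simp add: hyp_energy_def power2_eq_square)

section \<open>The second order inequality and its iteration\<close>

definition hyp_norm :: "real \<Rightarrow> (real ^ 'n \<Rightarrow> real) \<Rightarrow> real" where
  "hyp_norm p f = (\<integral>x. \<bar>f x\<bar> powr p \<partial>hyp_volume) powr (1 / p)"

lemma hyp_norm_nonneg: "0 \<le> hyp_norm p f"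
  by (simp add: hyp_norm_def)

lemma hyp_norm_powr:
  assumes "p \<noteq> 0"
  shows "hyp_norm p f powr a = (\<integral>x. \<bar>f x\<bar> powr p \<partial>hyp_volume) powr (a / p)"
  by (simp add: hyp_norm_def powr_powr)

text \<open>With X, a and b the L^q norm of f, the L^r norm of A f and the L^q' norm of f, the aim
  is X^s \<le> C (a X^(s-1) + b^2 X^(s-2)). Dividing by X^(s-2) leaves a quadratic inequality for X,
  which bounds X by a multiple of a + b.\<close>

lemma second_order_sobolev:
  fixes j :: real
  assumes dim: "3 \<le> CARD('n)"
  defines "n \<equiv> real CARD('n)"
  assumes j: "2 \<le> j" "2 * j < n"
  defines "r \<equiv> 2 * n / (n - 2 * (j - 2))" and "q' \<equiv> 2 * n / (n - 2 * (j - 1))" and "q \<equiv> 2 * n / (n - 2 * j)"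
  shows "\<exists>C>0. \<forall>f :: real ^ 'n \<Rightarrow> real. smooth_cc f \<longrightarrow>
    hyp_norm q f \<le> C * (hyp_norm r (shifted_laplacian f) + hyp_norm q' f)"
proof -
  have n: "3 \<le> n"
    using dim by (simp add: n_def)
  define p where "p = 2 * n / (n - 2)"
  have p: "2 < p" "p \<le> 2 * n / (n - 2)"
    using n by (auto simp: p_def field_simps)
  obtain C1 where C1: "0 < C1" "\<And>(w :: real ^ 'n \<Rightarrow> real) g. C1c_ball w g \<Longrightarrow>
      (\<integral>x. \<bar>w x\<bar> powr p \<partial>hyp_volume) powr (2 / p) \<le> C1 * hyp_energy w g"
    using poincare_sobolev[OF dim, of p] p unfolding n_def by blast
  \<comment> \<open>Chosen so that the L^p norm of |f|^(s/2) at the critical first order exponent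
    \<open>p\<close> is a power of the L^q norm of f; j > 1 makes s > 2.\<close>
  define s where "s = 2 * (n - 2) / (n - 2 * j)"
  have s: "2 < s"
    using j n by (simp add: s_def field_simps)
  have q: "0 < q" "0 < q'" "1 < r"
    using j n by (auto simp: q_def q'_def r_def field_simps)
  have sq: "s / 2 * p = q"
  proof -
    have "n - 2 \<noteq> 0" "n - 2 * j \<noteq> 0"
      using j n by auto
    then show ?thesis
      unfolding s_def p_def q_def by (simp add: divide_simps) (simp add: algebra_simps)
  qed
  \<comment> \<open>In these variables s-1 = h/d, s-2 = (h-d)/d, and r, q', q are 2n divided by d+4,
    d+2, d. Both Hoelder conjugacies then reduce to d + h + 4 = 2n.\<close>
  define d h where "d = n - 2 * j" and "h = n + 2 * j - 4"
  have dh: "0 < d" "0 < h" "0 < n" "d + h = 2 * n - 4"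
    using j n by (auto simp: d_def h_def)
  have sqd: "s = 2 * (n - 2) / d" "q = 2 * n / d"
    by (simp_all add: s_def q_def d_def)
  have rd: "r = 2 * n / (d + 4)" "q' = 2 * n / (d + 2)"
    by (simp_all add: r_def q'_def d_def algebra_simps)
  have s1: "s - 1 = h / d"
    using dh by (simp add: sqd h_def d_def field_simps)
  have s2: "s - 2 = (h - d) / d"
    using dh by (simp add: sqd h_def d_def field_simps)
  \<comment> \<open>The exponent conjugate to \<open>r\<close>. Since (s-1) r' is again
    \<open>q\<close>, testing A f against f |f|^(s-2) introduces no norm other than a and X.\<close>
  define r' where "r' = 2 * n / h"
  have r': "1 < r'" "1 / r + 1 / r' = 1" "(s - 1) * r' = q" "1 / r' = (s - 1) / q"
    unfolding s1 sqd(2) rd(1) r'_def using dh j n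
    by (auto simp: h_def d_def add_divide_distrib[symmetric])
  have t: "1 < q' / 2" "1 < q / (s - 2)" "1 / (q' / 2) + 1 / (q / (s - 2)) = 1"
    unfolding s2 sqd(2) rd(2) using dh j n
    by (auto simp: h_def d_def add_divide_distrib[symmetric])
  have s_q: "2 / p = s / q"
    using dh by (simp add: sqd p_def)
  define H where "H = (n - 1)\<^sup>2 / 4"
  have H: "0 \<le> H"
    by (simp add: H_def)
  define C2 where "C2 = C1 * (s\<^sup>2 / 4) / (s - 1) * (1 + H)"
  have C2: "0 < C2"
    using C1 s H by (auto simp: C2_def intro!: mult_pos_pos divide_pos_pos add_pos_nonneg)
  have "hyp_norm q f \<le> (1 + 2 * C2) * (hyp_norm r (shifted_laplacian f) + hyp_norm q' f)"
    if f: "smooth_cc f" for f :: "real ^ 'n \<Rightarrow> real"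
  proof -
    note fC = smooth_cc_C1c[OF f]
    note cc = C1c_ball_cc[OF fC]
    note ccA = smooth_cc_cc[OF smooth_cc_shifted_laplacian[OF f]]
    have ccp: "cc_ball (\<lambda>x. \<bar>f x\<bar> powr a)" if "0 < a" for a
      using that cc by (intro cc_ball_powr)
    define a where "a = hyp_norm r (shifted_laplacian f)"
    define b where "b = hyp_norm q' f"
    define X where "X = hyp_norm q f"
    define P where "P = (\<integral>x. (rho x)\<^sup>2 * (\<bar>f x\<bar> powr (s - 2) * (grad f x \<bullet> grad f x)) \<partial>hyp_volume)"
    define I where "I = (\<integral>x. \<bar>f x\<bar> powr s \<partial>hyp_volume)"
    have ab: "0 \<le> a" "0 \<le> b" "0 \<le> X" "0 \<le> I"
      by (auto simp: a_def b_def X_def I_def hyp_norm_nonneg intro!: integral_nonneg_AE)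
    have ccP: "cc_ball (\<lambda>x. (rho x)\<^sup>2 * (\<bar>f x\<bar> powr (s - 2) * (grad f x \<bullet> grad f x)))"
      using s by (intro cc_ball_mult cc_ball_inner cc continuous_intros cc_ball_continuous ccp) auto
    have ccI: "cc_ball (\<lambda>x. \<bar>f x\<bar> powr s)"
      using s by (intro ccp) simp
    have integral_PI: "(\<integral>x. c * ((rho x)\<^sup>2 * (\<bar>f x\<bar> powr (s - 2) * (grad f x \<bullet> grad f x)))
        - d * \<bar>f x\<bar> powr s \<partial>hyp_volume) = c * P - d * I" for c d
      using ccP[THEN integrable_hyp_volume] ccI[THEN integrable_hyp_volume] by (simp add: P_def I_def)
    have \<phi>: "C1c_ball (\<lambda>x. f x * \<bar>f x\<bar> powr (s - 2)) (\<lambda>x. ((s - 2 + 1) * \<bar>f x\<bar> powr (s - 2)) *\<^sub>R grad f x)"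
      using s by (intro C1c_ball_chain[OF fC, of "\<lambda>y. y * \<bar>y\<bar> powr (s - 2)" "\<lambda>y. (s - 2 + 1) * \<bar>y\<bar> powr (s - 2)"]
          DERIV_sgn_abs_powr continuous_on_mult continuous_on_powr' continuous_intros) auto
    have f_powr: "f x * (f x * \<bar>f x\<bar> powr (s - 2)) = \<bar>f x\<bar> powr s" for x
    proof (cases "f x = 0")
      case False
      have "f x * (f x * \<bar>f x\<bar> powr (s - 2)) = \<bar>f x\<bar> powr 2 * \<bar>f x\<bar> powr (s - 2)"
        by (simp add: power2_eq_square)
      also have "\<dots> = \<bar>f x\<bar> powr s"
        using powr_add[of "\<bar>f x\<bar>" 2 "s - 2"] by simp
      finally show ?thesis .
    qed (use s in auto)
    have weak: "(\<integral>x. shifted_laplacian f x * (f x * \<bar>f x\<bar> powr (s - 2)) \<partial>hyp_volume) = (s - 1) * P - H * I"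
      using shifted_laplacian_weak[OF f \<phi>] unfolding f_powr integral_PI[symmetric] H_def n_def
      by (simp add: mult_ac)
    have w: "C1c_ball (\<lambda>x. \<bar>f x\<bar> powr (s / 2))
        (\<lambda>x. (s / 2 * (sgn (f x) * \<bar>f x\<bar> powr (s / 2 - 1))) *\<^sub>R grad f x)"
      using s by (intro C1c_ball_chain[OF fC, of "\<lambda>y. \<bar>y\<bar> powr (s / 2)" "\<lambda>y. s / 2 * (sgn y * \<bar>y\<bar> powr (s / 2 - 1))"]
          DERIV_abs_powr continuous_on_mult continuous_on_sgn_powr continuous_on_const) auto
    have energy: "hyp_energy (\<lambda>x. \<bar>f x\<bar> powr (s / 2))
        (\<lambda>x. (s / 2 * (sgn (f x) * \<bar>f x\<bar> powr (s / 2 - 1))) *\<^sub>R grad f x) = s\<^sup>2 / 4 * P - H * I"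
    proof -
      have "(sgn (f x) * \<bar>f x\<bar> powr (s / 2 - 1)) * (sgn (f x) * \<bar>f x\<bar> powr (s / 2 - 1)) = \<bar>f x\<bar> powr (s - 2)" for x
      proof (cases "f x = 0")
        case False
        then have "(sgn (f x) * \<bar>f x\<bar> powr (s / 2 - 1)) * (sgn (f x) * \<bar>f x\<bar> powr (s / 2 - 1))
          = \<bar>f x\<bar> powr (s / 2 - 1) * \<bar>f x\<bar> powr (s / 2 - 1)"
          by (simp add: sgn_if)
        also have "\<dots> = \<bar>f x\<bar> powr (s - 2)"
          by (simp flip: powr_add)
        finally show ?thesis .
      qed simp
      then have g2: "((s / 2 * (sgn (f x) * \<bar>f x\<bar> powr (s / 2 - 1))) *\<^sub>R grad f x)
          \<bullet> ((s / 2 * (sgn (f x) * \<bar>f x\<bar> powr (s / 2 - 1))) *\<^sub>R grad f x)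
        = s\<^sup>2 / 4 * (\<bar>f x\<bar> powr (s - 2) * (grad f x \<bullet> grad f x))" for x
        by (simp add: power2_eq_square algebra_simps)
      have w2: "(\<bar>f x\<bar> powr (s / 2))\<^sup>2 = \<bar>f x\<bar> powr s" for x
        by (simp add: power2_eq_square flip: powr_add)
      show ?thesis
        unfolding hyp_energy_def g2 w2 integral_PI[symmetric] H_def n_def
        by (intro Bochner_Integration.integral_cong) auto
    qed
    have "X powr s = (\<integral>x. \<bar>\<bar>f x\<bar> powr (s / 2)\<bar> powr p \<partial>hyp_volume) powr (2 / p)"
    proof -
      have "\<bar>\<bar>f x\<bar> powr (s / 2)\<bar> powr p = \<bar>f x\<bar> powr q" for x
        using sq by (simp add: powr_powr)
      then show ?thesis
        unfolding X_def s_q using q by (simp add: hyp_norm_powr)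
    qed
    also have "\<dots> \<le> C1 * (s\<^sup>2 / 4 * P - H * I)"
      using C1(2)[OF w] unfolding energy .
    \<comment> \<open>Here -H I has the favourable sign and is dropped. The copy of H I that enters
      when \<open>P\<close> is expressed by the tested equation has to be estimated.\<close>
    also have "\<dots> \<le> C1 * (s\<^sup>2 / 4 * P)"
      using C1(1) H ab by (intro mult_left_mono) auto
    also have "P = ((\<integral>x. shifted_laplacian f x * (f x * \<bar>f x\<bar> powr (s - 2)) \<partial>hyp_volume) + H * I) / (s - 1)"
      unfolding weak using s by simp
    also have "C1 * (s\<^sup>2 / 4 * (((\<integral>x. shifted_laplacian f x * (f x * \<bar>f x\<bar> powr (s - 2)) \<partial>hyp_volume) + H * I) / (s - 1)))
      \<le> C1 * (s\<^sup>2 / 4 * ((a * X powr (s - 1) + H * (b powr 2 * X powr (s - 2))) / (s - 1)))"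
    proof (intro mult_left_mono divide_right_mono add_mono)
      have "(\<integral>x. shifted_laplacian f x * (f x * \<bar>f x\<bar> powr (s - 2)) \<partial>hyp_volume)
        \<le> (\<integral>x. \<bar>shifted_laplacian f x\<bar> * \<bar>\<bar>f x\<bar> powr (s - 1)\<bar> \<partial>hyp_volume)"
      proof (rule integral_mono)
        fix x
        have "\<bar>f x * \<bar>f x\<bar> powr (s - 2)\<bar> = \<bar>f x\<bar> powr (s - 1)"
        proof (cases "f x = 0")
          case False
          have "\<bar>f x * \<bar>f x\<bar> powr (s - 2)\<bar> = \<bar>f x\<bar> powr 1 * \<bar>f x\<bar> powr (s - 2)"
            using False by (simp add: abs_mult)
          also have "\<dots> = \<bar>f x\<bar> powr (s - 1)"
            using powr_add[of "\<bar>f x\<bar>" 1 "s - 2"] by simp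
          finally show ?thesis .
        qed (use s in auto)
        then have "\<bar>shifted_laplacian f x * (f x * \<bar>f x\<bar> powr (s - 2))\<bar> = \<bar>shifted_laplacian f x\<bar> * \<bar>\<bar>f x\<bar> powr (s - 1)\<bar>"
          by (simp add: abs_mult)
        then show "shifted_laplacian f x * (f x * \<bar>f x\<bar> powr (s - 2)) \<le> \<bar>shifted_laplacian f x\<bar> * \<bar>\<bar>f x\<bar> powr (s - 1)\<bar>"
          by (metis abs_ge_self)
      next
        show "integrable hyp_volume (\<lambda>x. shifted_laplacian f x * (f x * \<bar>f x\<bar> powr (s - 2)))"
          by (intro integrable_hyp_volume cc_ball_mult C1c_ball_cc[OF \<phi>] cc_ball_continuous[OF ccA])
        show "integrable hyp_volume (\<lambda>x. \<bar>shifted_laplacian f x\<bar> * \<bar>\<bar>f x\<bar> powr (s - 1)\<bar>)"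
          using s by (intro integrable_hyp_volume cc_ball_mult cc_ball_abs ccp cc_ball_continuous ccA) auto
      qed
      also have "\<dots> \<le> (\<integral>x. \<bar>shifted_laplacian f x\<bar> powr r \<partial>hyp_volume) powr (1 / r)
          * (\<integral>x. \<bar>\<bar>f x\<bar> powr (s - 1)\<bar> powr r' \<partial>hyp_volume) powr (1 / r')"
        using s q r' by (intro hyp_volume_Holder ccA ccp) auto
      also have "\<dots> = a * X powr (s - 1)"
        using q by (simp add: a_def X_def hyp_norm_powr powr_powr r'(3,4)) (simp add: hyp_norm_def)
      finally show "(\<integral>x. shifted_laplacian f x * (f x * \<bar>f x\<bar> powr (s - 2)) \<partial>hyp_volume) \<le> a * X powr (s - 1)" .
      \<comment> \<open>Hoelder for |f|^2 |f|^(s-2) with exponents q'/2 and q/(s-2).\<close>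
      have "I = (\<integral>x. \<bar>\<bar>f x\<bar> powr 2\<bar> * \<bar>\<bar>f x\<bar> powr (s - 2)\<bar> \<partial>hyp_volume)"
        unfolding I_def using powr_add[of "\<bar>f _\<bar>" 2 "s - 2"]
        by (intro Bochner_Integration.integral_cong) auto
      also have "\<dots> \<le> (\<integral>x. \<bar>\<bar>f x\<bar> powr 2\<bar> powr (q' / 2) \<partial>hyp_volume) powr (1 / (q' / 2))
          * (\<integral>x. \<bar>\<bar>f x\<bar> powr (s - 2)\<bar> powr (q / (s - 2)) \<partial>hyp_volume) powr (1 / (q / (s - 2)))"
        using s t by (intro hyp_volume_Holder ccp) auto
      also have "\<dots> = b powr 2 * X powr (s - 2)"
      proof -
        have *: "\<bar>\<bar>f x\<bar> powr 2\<bar> powr (q' / 2) = \<bar>f x\<bar> powr q'"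
          "\<bar>\<bar>f x\<bar> powr (s - 2)\<bar> powr (q / (s - 2)) = \<bar>f x\<bar> powr q" for x
          using s by (simp_all only: abs_of_nonneg powr_ge_zero powr_powr) auto
        have ne: "q \<noteq> 0" "q' \<noteq> 0"
          using q by auto
        show ?thesis
          unfolding * b_def X_def hyp_norm_powr[OF ne(1)] hyp_norm_powr[OF ne(2)] by simp
      qed
      finally show "I \<le> b powr 2 * X powr (s - 2)" .
    qed (use C1 s H in auto)
    also have "\<dots> \<le> C1 * (s\<^sup>2 / 4 * (((1 + H) * (a * X powr (s - 1) + b powr 2 * X powr (s - 2))) / (s - 1)))"
    proof -
      have "0 \<le> b powr 2 * X powr (s - 2)" "0 \<le> H * (a * X powr (s - 1))"
        using ab H by auto
      then show ?thesis
        using C1 s by (intro mult_left_mono divide_right_mono) (auto simp: algebra_simps)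
    qed
    also have "\<dots> = C2 * (a * X powr (s - 1) + b powr 2 * X powr (s - 2))"
      by (simp add: C2_def)
    finally have main: "X powr s \<le> C2 * (a * X powr (s - 1) + b powr 2 * X powr (s - 2))" .
    show ?thesis
    \<comment> \<open>If X exceeds a + b, then b^2 is at most (a + b) X, and dividing the quadratic
      inequality by X makes it linear.\<close>
    proof (cases "X \<le> a + b")
      case True
      have "X \<le> 1 * (a + b)"
        using True by simp
      also have "\<dots> \<le> (1 + 2 * C2) * (a + b)"
        using C2 ab by (intro mult_right_mono) auto
      finally show ?thesis
        by (simp add: X_def a_def b_def)
    next
      case False
      then have X: "0 < X" "a + b < X"
        using ab by auto
      have "X powr (s - 2) * (X * X) = X powr s"
      proof -
        have "X powr (s - 2) * (X * X) = X powr (s - 2) * X powr 2"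
          using X by (simp add: power2_eq_square)
        also have "\<dots> = X powr s"
          using powr_add[of X "s - 2" 2] by simp
        finally show ?thesis .
      qed
      moreover have "X powr (s - 1) = X powr (s - 2) * X"
      proof -
        have "X powr (s - 2) * X = X powr (s - 2) * X powr 1"
          using X by simp
        also have "\<dots> = X powr (s - 1)"
          using powr_add[of X "s - 2" 1] by simp
        finally show ?thesis ..
      qed
      moreover have "b powr 2 = b * b"
        using ab by (simp add: power2_eq_square)
      ultimately have "X powr (s - 2) * (X * X) \<le> X powr (s - 2) * (C2 * (a * X + b * b))"
        using main by (simp add: algebra_simps)
      then have "X * X \<le> C2 * (a * X + b * b)"
        using X by simp
      also have "\<dots> \<le> C2 * ((a + b) * X + (a + b) * X)"
        using C2 ab X by (intro mult_left_mono add_mono mult_mono) auto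
      also have "\<dots> = 2 * C2 * (a + b) * X"
        by simp
      finally have "X \<le> 2 * C2 * (a + b)"
        using X by simp
      also have "\<dots> \<le> (1 + 2 * C2) * (a + b)"
        using ab by (simp add: algebra_simps)
      finally show ?thesis
        by (simp add: X_def a_def b_def)
    qed
  qed
  moreover have "0 < 1 + 2 * C2"
    using C2 by simp
  ultimately show ?thesis
    by blast
qed

section \<open>Powers of the shifted Laplacian and the quadratic forms they define\<close>

lemma smooth_cc_iterate: "smooth_cc f \<Longrightarrow> smooth_cc ((shifted_laplacian ^^ j) f)"
  by (induction j) (auto intro: smooth_cc_shifted_laplacian)

lemma iterate_lin:
  assumes "smooth_cc f" "smooth_cc g"
  shows "(shifted_laplacian ^^ j) (\<lambda>x. f x + c * g x)
    = (\<lambda>x. (shifted_laplacian ^^ j) f x + c * (shifted_laplacian ^^ j) g x)"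
  using assms by (induction j) (simp_all add: shifted_laplacian_lin smooth_cc_iterate)

lemma iterate_sym:
  assumes "smooth_cc f" "smooth_cc g"
  shows "(\<integral>x. (shifted_laplacian ^^ (i + j)) f x * g x \<partial>hyp_volume)
    = (\<integral>x. (shifted_laplacian ^^ j) f x * (shifted_laplacian ^^ i) g x \<partial>hyp_volume)"
  using assms(2)
proof (induction i arbitrary: g)
  case (Suc i)
  have "(\<integral>x. (shifted_laplacian ^^ (Suc i + j)) f x * g x \<partial>hyp_volume)
    = (\<integral>x. (shifted_laplacian ^^ (i + j)) f x * shifted_laplacian g x \<partial>hyp_volume)"
    using assms Suc.prems by (simp add: shifted_laplacian_sym smooth_cc_iterate)
  also have "\<dots> = (\<integral>x. (shifted_laplacian ^^ j) f x * (shifted_laplacian ^^ i) (shifted_laplacian g) x \<partial>hyp_volume)"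
    using Suc.prems by (intro Suc.IH smooth_cc_shifted_laplacian)
  finally show ?case
    by (simp add: funpow_swap1)
qed simp

lemma hyp_energy_nonneg:
  assumes "C1c_ball w (g :: real ^ 'n \<Rightarrow> real ^ 'n)" shows "0 \<le> hyp_energy w g"
proof -
  have "1 \<le> real CARD('n)"
    by (simp add: Suc_leI)
  then show ?thesis
    unfolding hyp_energy_twisted[OF assms]
    using rho_nonneg_mult[OF cc_ball_square[OF C1c_ball_cc(1)[OF assms]]]
    by (intro add_nonneg_nonneg mult_nonneg_nonneg integral_nonneg_AE) auto
qed

lemma iterate_even:
  assumes "smooth_cc f"
  shows "(\<integral>x. (shifted_laplacian ^^ (2 * i)) f x * f x \<partial>hyp_volume)
    = (\<integral>x. ((shifted_laplacian ^^ i) f x)\<^sup>2 \<partial>hyp_volume)"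
  using iterate_sym[OF assms assms, of i i] by (simp add: mult_2 power2_eq_square)

lemma iterate_odd:
  assumes "smooth_cc f"
  shows "(\<integral>x. (shifted_laplacian ^^ (2 * i + 1)) f x * f x \<partial>hyp_volume)
    = hyp_energy ((shifted_laplacian ^^ i) f) (grad ((shifted_laplacian ^^ i) f))"
  using iterate_sym[OF assms assms, of i "Suc i"]
  by (simp add: hyp_energy_shifted_laplacian[OF smooth_cc_iterate[OF assms]] mult_2)

text \<open>Symmetry shares the factors between the two arguments: an even power becomes a squared
  L^2 norm, an odd one the energy of an iterate.\<close>

lemma iterate_nonneg:
  assumes "smooth_cc f"
  shows "0 \<le> (\<integral>x. (shifted_laplacian ^^ j) f x * f x \<partial>hyp_volume)"
proof (cases "even j")
  case True
  then obtain i where "j = 2 * i"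
    by (elim evenE)
  then show ?thesis
    using iterate_even[OF assms, of i] by simp
next
  case False
  then obtain i where j: "j = 2 * i + 1"
    by (elim oddE)
  show ?thesis
    unfolding j iterate_odd[OF assms]
    by (intro hyp_energy_nonneg smooth_cc_C1c smooth_cc_iterate assms)
qed

text \<open>The sum starts at 1 because the term j = 0 is the integral of f^2, exactly what the
  theorem subtracts. The weights are taken to be 1, since the positive coefficients of the GJMS
  operator can be bounded below by their minimum.\<close>

definition laplacian_form :: "nat \<Rightarrow> (real ^ 'n \<Rightarrow> real) \<Rightarrow> real" where
  "laplacian_form k f = (\<Sum>j=1..k. \<integral>x. (shifted_laplacian ^^ j) f x * f x \<partial>hyp_volume)"

lemma laplacian_form_ge:
  assumes "smooth_cc f" "1 \<le> j" "j \<le> k"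
  shows "(\<integral>x. (shifted_laplacian ^^ j) f x * f x \<partial>hyp_volume) \<le> laplacian_form k f"
  unfolding laplacian_form_def using assms iterate_nonneg by (intro member_le_sum) auto

lemma laplacian_form_nonneg: "smooth_cc f \<Longrightarrow> 0 \<le> laplacian_form k f"
  unfolding laplacian_form_def by (intro sum_nonneg iterate_nonneg)

text \<open>The argument \<open>T\<close> only fixes the dimension, which no other argument
  mentions. The norm is squared to match the homogeneity of the quadratic form.\<close>

definition controlled :: "'n::finite itself \<Rightarrow> nat \<Rightarrow> nat \<Rightarrow> real \<Rightarrow> bool" where
  "controlled T k i p \<longleftrightarrow> (\<exists>C>0. \<forall>f :: real ^ 'n \<Rightarrow> real. smooth_cc f \<longrightarrow>
     (hyp_norm p ((shifted_laplacian ^^ i) f))\<^sup>2 \<le> C * laplacian_form k f)"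

lemma hyp_norm_square:
  assumes "p \<noteq> 0"
  shows "(hyp_norm p f)\<^sup>2 = (\<integral>x. \<bar>f x\<bar> powr p \<partial>hyp_volume) powr (2 / p)"
  using hyp_norm_powr[OF assms, of f 2] hyp_norm_nonneg[of p f] by simp

lemma controlled_L2:
  assumes "1 \<le> i" "2 * i \<le> k"
  shows "controlled TYPE('n::finite) k i 2"
proof -
  have "(hyp_norm 2 ((shifted_laplacian ^^ i) f))\<^sup>2 \<le> 1 * laplacian_form k f"
    if "smooth_cc f" for f :: "real ^ 'n \<Rightarrow> real"
  proof -
    have "(hyp_norm 2 ((shifted_laplacian ^^ i) f))\<^sup>2
      = (\<integral>x. (shifted_laplacian ^^ (2 * i)) f x * f x \<partial>hyp_volume)"
      unfolding iterate_even[OF that] by (simp add: hyp_norm_square integral_nonneg_AE)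
    also have "\<dots> \<le> laplacian_form k f"
      using assms that by (intro laplacian_form_ge) auto
    finally show ?thesis
      by simp
  qed
  then show ?thesis
    unfolding controlled_def by (intro exI[of _ 1]) auto
qed

lemma controlled_first_order:
  assumes "3 \<le> CARD('n::finite)" "2 * i + 1 \<le> k"
    and p: "2 < p" "p \<le> 2 * real CARD('n) / (real CARD('n) - 2)"
  shows "controlled TYPE('n) k i p"
proof -
  obtain C where C: "0 < C" "\<And>(w :: real ^ 'n \<Rightarrow> real) g. C1c_ball w g \<Longrightarrow>
      (\<integral>x. \<bar>w x\<bar> powr p \<partial>hyp_volume) powr (2 / p) \<le> C * hyp_energy w g"
    using poincare_sobolev[OF assms(1) p] by blast
  have "(hyp_norm p ((shifted_laplacian ^^ i) f))\<^sup>2 \<le> C * laplacian_form k f"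
    if f: "smooth_cc f" for f :: "real ^ 'n \<Rightarrow> real"
  proof -
    have "(hyp_norm p ((shifted_laplacian ^^ i) f))\<^sup>2
      \<le> C * hyp_energy ((shifted_laplacian ^^ i) f) (grad ((shifted_laplacian ^^ i) f))"
      using p C(2)[OF smooth_cc_C1c[OF smooth_cc_iterate[OF f]]] by (simp add: hyp_norm_square)
    also have "\<dots> \<le> C * laplacian_form k f"
      unfolding iterate_odd[OF f, symmetric] using assms C f
      by (intro mult_left_mono laplacian_form_ge) auto
    finally show ?thesis .
  qed
  then show ?thesis
    unfolding controlled_def using C(1) by blast
qed

lemma controlled_second_order:
  fixes j :: real
  assumes dim: "3 \<le> CARD('n::finite)"
  defines "n \<equiv> real CARD('n)"
  assumes j: "2 \<le> j" "2 * j < n"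
    and r: "controlled TYPE('n) k (Suc i) (2 * n / (n - 2 * (j - 2)))"
    and q': "controlled TYPE('n) k i (2 * n / (n - 2 * (j - 1)))"
  shows "controlled TYPE('n) k i (2 * n / (n - 2 * j))"
proof -
  let ?r = "2 * n / (n - 2 * (j - 2))" and ?q' = "2 * n / (n - 2 * (j - 1))" and ?q = "2 * n / (n - 2 * j)"
  obtain C where C: "0 < C" "\<And>f :: real ^ 'n \<Rightarrow> real. smooth_cc f \<Longrightarrow>
      hyp_norm ?q f \<le> C * (hyp_norm ?r (shifted_laplacian f) + hyp_norm ?q' f)"
    using second_order_sobolev[OF dim, of j] j unfolding n_def by blast
  obtain C1 where C1: "0 < C1" "\<And>f :: real ^ 'n \<Rightarrow> real. smooth_cc f \<Longrightarrow>
      (hyp_norm ?r ((shifted_laplacian ^^ Suc i) f))\<^sup>2 \<le> C1 * laplacian_form k f"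
    using r unfolding controlled_def by blast
  obtain C2 where C2: "0 < C2" "\<And>f :: real ^ 'n \<Rightarrow> real. smooth_cc f \<Longrightarrow>
      (hyp_norm ?q' ((shifted_laplacian ^^ i) f))\<^sup>2 \<le> C2 * laplacian_form k f"
    using q' unfolding controlled_def by blast
  have "(hyp_norm ?q ((shifted_laplacian ^^ i) f))\<^sup>2 \<le> (C\<^sup>2 * (2 * C1 + 2 * C2)) * laplacian_form k f"
    if f: "smooth_cc f" for f :: "real ^ 'n \<Rightarrow> real"
  proof -
    define a where "a = hyp_norm ?r ((shifted_laplacian ^^ Suc i) f)"
    define b where "b = hyp_norm ?q' ((shifted_laplacian ^^ i) f)"
    have "(hyp_norm ?q ((shifted_laplacian ^^ i) f))\<^sup>2 \<le> (C * (a + b))\<^sup>2"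
      using C(2)[OF smooth_cc_iterate[OF f, of i]]
      by (intro power_mono hyp_norm_nonneg) (simp add: a_def b_def)
    also have "\<dots> = C\<^sup>2 * (a + b)\<^sup>2"
      by (simp add: power_mult_distrib)
    also have "\<dots> \<le> C\<^sup>2 * (2 * a\<^sup>2 + 2 * b\<^sup>2)"
      using sum_squares_bound[of a b] by (intro mult_left_mono) (auto simp: power2_sum)
    also have "\<dots> \<le> C\<^sup>2 * (2 * (C1 * laplacian_form k f) + 2 * (C2 * laplacian_form k f))"
      using C1(2)[OF f] C2(2)[OF f] by (intro mult_left_mono add_mono) (auto simp: a_def b_def)
    finally show ?thesis
      by (simp add: algebra_simps)
  qed
  moreover have "0 < C\<^sup>2 * (2 * C1 + 2 * C2)"
    using C(1) C1(1) C2(1) by (intro mult_pos_pos add_pos_pos) auto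
  ultimately show ?thesis
    unfolding controlled_def by blast
qed

text \<open>Each application of A counts as two derivatives and each step in j as one, which
  explains 2i + j \<le> k. The pair (i, j) is reduced to (i+1, j-2) and (i, j-1), and both keep this
  bound and i + j \<ge> 1. Hence (0, 0), the L^2 norm of f itself, is never reached.\<close>

lemma controlled_iterated:
  assumes dim: "3 \<le> CARD('n::finite)" "2 * k < CARD('n)"
  defines "n \<equiv> real CARD('n)"
  assumes ij: "2 * i + j \<le> k" "1 \<le> i + j"
  shows "controlled TYPE('n) k i (2 * n / (n - 2 * real j))"
  using ij
proof (induction j arbitrary: i rule: less_induct)
  case (less j)
  have n: "3 \<le> n"
    using dim by (simp add: n_def)
  consider "j = 0" | "j = 1" | "2 \<le> j"
    by linarith
  then show ?case
  proof cases
    case 1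
    then have "2 * n / (n - 2 * real j) = 2"
      using n by simp
    then show ?thesis
      using controlled_L2[where ?'n='n, of i k] less.prems 1 by simp
  next
    case 2
    have "2 < 2 * n / (n - 2)"
      using n by (simp add: field_simps)
    then show ?thesis
      using controlled_first_order[where ?'n='n, of i k] dim less.prems 2 by (simp add: n_def)
  next
    case 3
    have "2 * real j < n"
      using dim less.prems unfolding n_def by linarith
    moreover have "controlled TYPE('n) k (Suc i) (2 * n / (n - 2 * real (j - 2)))"
      using less.prems 3 by (intro less.IH) auto
    moreover have "controlled TYPE('n) k i (2 * n / (n - 2 * real (j - 1)))"
      using less.prems 3 by (intro less.IH) auto
    ultimately show ?thesis
      using controlled_second_order[where ?'n='n, of "real j" k i] dim 3
      by (simp add: n_def of_nat_diff)
  qed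
qed

lemma controlled_interpolate:
  assumes "controlled TYPE('n::finite) k i p0" "controlled TYPE('n) k i p1" "1 \<le> p0" "p0 \<le> p" "p \<le> p1"
  shows "controlled TYPE('n) k i p"
proof -
  obtain C0 where C0: "0 < C0" "\<And>f :: real ^ 'n \<Rightarrow> real. smooth_cc f \<Longrightarrow>
      (hyp_norm p0 ((shifted_laplacian ^^ i) f))\<^sup>2 \<le> C0 * laplacian_form k f"
    using assms(1) unfolding controlled_def by blast
  obtain C1 where C1: "0 < C1" "\<And>f :: real ^ 'n \<Rightarrow> real. smooth_cc f \<Longrightarrow>
      (hyp_norm p1 ((shifted_laplacian ^^ i) f))\<^sup>2 \<le> C1 * laplacian_form k f"
    using assms(2) unfolding controlled_def by blast
  have "(hyp_norm p ((shifted_laplacian ^^ i) f))\<^sup>2 \<le> (4 * (C0 + C1)) * laplacian_form k f"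
    if f: "smooth_cc f" for f :: "real ^ 'n \<Rightarrow> real"
  proof -
    let ?g = "(shifted_laplacian ^^ i) f"
    define N where "N = sqrt ((C0 + C1) * laplacian_form k f)"
    have L: "0 \<le> laplacian_form k f"
      using f by (rule laplacian_form_nonneg)
    then have N: "0 \<le> N" "N\<^sup>2 = (C0 + C1) * laplacian_form k f"
      using C0(1) C1(1) by (auto simp: N_def)
    have bound: "(\<integral>x. \<bar>?g x\<bar> powr a \<partial>hyp_volume) \<le> N powr a"
      if "1 \<le> a" "(hyp_norm a ?g)\<^sup>2 \<le> N\<^sup>2" for a
    proof -
      have "hyp_norm a ?g \<le> N"
        using that(2) N(1) power2_le_imp_le by blast
      then have "hyp_norm a ?g powr a \<le> N powr a"
        using that(1) by (intro powr_mono2 hyp_norm_nonneg) auto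
      also have "hyp_norm a ?g powr a = (\<integral>x. \<bar>?g x\<bar> powr a \<partial>hyp_volume)"
        using that(1) by (simp add: hyp_norm_powr integral_nonneg_AE)
      finally show ?thesis .
    qed
    have "0 \<le> C0 * laplacian_form k f" "0 \<le> C1 * laplacian_form k f"
      using L C0(1) C1(1) by auto
    then have "(hyp_norm p0 ?g)\<^sup>2 \<le> N\<^sup>2" "(hyp_norm p1 ?g)\<^sup>2 \<le> N\<^sup>2"
      using C0(2)[OF f] C1(2)[OF f] unfolding N by (auto simp: distrib_right)
    then have "(\<integral>x. \<bar>?g x\<bar> powr p \<partial>hyp_volume) \<le> 2 * N powr p"
      using assms N f
      by (intro hyp_volume_interpolate[of ?g p0 p p1] bound smooth_cc_cc smooth_cc_iterate) auto
    then have "hyp_norm p ?g \<le> (2 * N powr p) powr (1 / p)"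
      unfolding hyp_norm_def using assms by (intro powr_mono2 integral_nonneg_AE) auto
    also have "\<dots> = 2 powr (1 / p) * N"
      using assms N by (simp add: powr_mult powr_powr)
    \<comment> \<open>As \<open>p\<close> is at least 1, the factor 2^(1/p) is at most 2; squaring
      gives the constant 4 (C0 + C1).\<close>
    also have "\<dots> \<le> 2 powr 1 * N"
      using assms N by (intro mult_right_mono powr_mono) auto
    finally have "(hyp_norm p ?g)\<^sup>2 \<le> (2 * N)\<^sup>2"
      by (intro power_mono hyp_norm_nonneg) simp
    then show ?thesis
      using N by (simp add: power_mult_distrib algebra_simps)
  qed
  moreover have "0 < 4 * (C0 + C1)"
    using C0(1) C1(1) by simp
  ultimately show ?thesis
    unfolding controlled_def by blast
qed

section \<open>The GJMS operator as a polynomial in the shifted Laplacian\<close>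

lemma conf_laplacian_shifted:
  "conf_laplacian u x + real (Suc k) * real k * u x = shifted_laplacian u x + (2 * real (Suc k) - 1)\<^sup>2 / 4 * u x"
  \<comment> \<open>From n(n-2)/4 = (n-1)^2/4 - 1/4 and k(k+1) + 1/4 = (2k+1)^2/4.\<close>
  by (simp add: conf_laplacian_def shifted_laplacian_def power2_eq_square field_simps)

text \<open>The polynomial is the product of the factors y + (2i-1)^2/4. Their constants are
  positive, so no coefficient of the product vanishes, and the constant coefficient is the one in
  the theorem.\<close>

lemma gjms_expansion:
  "\<exists>c :: nat \<Rightarrow> real. c 0 = (\<Prod>i=1..k. (2 * real i - 1)\<^sup>2 / 4) \<and> (\<forall>j\<le>k. 0 < c j) \<and>
    (\<forall>u :: real ^ 'n \<Rightarrow> real. smooth_cc u \<longrightarrow> gjms k u = (\<lambda>x. \<Sum>j\<le>k. c j * (shifted_laplacian ^^ j) u x))"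
proof (induction k)
  case 0
  then show ?case
    by (intro exI[of _ "\<lambda>_. 1"]) auto
next
  case (Suc k)
  then obtain c :: "nat \<Rightarrow> real" where c0: "c 0 = (\<Prod>i=1..k. (2 * real i - 1)\<^sup>2 / 4)" and c_pos: "\<And>j. j \<le> k \<Longrightarrow> 0 < c j"
    and c: "\<And>u :: real ^ 'n \<Rightarrow> real. smooth_cc u \<Longrightarrow> gjms k u = (\<lambda>x. \<Sum>j\<le>k. c j * (shifted_laplacian ^^ j) u x)"
    by blast
  define a where "a = (2 * real (Suc k) - 1)\<^sup>2 / 4"
  have a: "0 < a"
    by (simp add: a_def)
  \<comment> \<open>Coefficients of (y + a) times the previous polynomial. The second conditional
    guards \<open>j - 1\<close> at 0, where natural subtraction would return the index 0.\<close>
  define c' where "c' j = (if j \<le> k then a * c j else 0) + (if j = 0 then 0 else c (j - 1))" for j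
  have "c' 0 = (\<Prod>i=1..Suc k. (2 * real i - 1)\<^sup>2 / 4)"
    by (simp add: c'_def c0 a_def)
  moreover have "0 < c' j" if "j \<le> Suc k" for j
    using that a c_pos[of j] c_pos[of "j - 1"] by (auto simp: c'_def add_pos_pos le_Suc_eq)
  moreover have "gjms (Suc k) u = (\<lambda>x. \<Sum>j\<le>Suc k. c' j * (shifted_laplacian ^^ j) u x)"
    if u: "smooth_cc u" for u :: "real ^ 'n \<Rightarrow> real"
  proof
    fix x
    have Au: "smooth_cc (shifted_laplacian u)" "smooth_cc (\<lambda>x. shifted_laplacian u x + a * u x)"
      using u by (auto intro!: smooth_cc_add smooth_cc_shifted_laplacian smooth_cc_cmult)
    have "gjms (Suc k) u x = gjms k (\<lambda>x. shifted_laplacian u x + a * u x) x"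
      unfolding gjms.simps conf_laplacian_shifted a_def ..
    also have "\<dots> = (\<Sum>j\<le>k. c j * (shifted_laplacian ^^ j) (\<lambda>x. shifted_laplacian u x + a * u x) x)"
      using c[OF Au(2)] by simp
    also have "\<dots> = (\<Sum>j\<le>k. c j * (shifted_laplacian ^^ Suc j) u x + a * c j * (shifted_laplacian ^^ j) u x)"
      using u Au by (simp add: iterate_lin funpow_swap1 algebra_simps)
    also have "\<dots> = (\<Sum>j\<le>k. c j * (shifted_laplacian ^^ Suc j) u x) + (\<Sum>j\<le>k. a * c j * (shifted_laplacian ^^ j) u x)"
      by (rule sum.distrib)
    also have "(\<Sum>j\<le>k. c j * (shifted_laplacian ^^ Suc j) u x)
      = (\<Sum>j\<le>Suc k. (if j = 0 then 0 else c (j - 1)) * (shifted_laplacian ^^ j) u x)"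
      by (subst sum.atMost_Suc_shift) simp
    also have "(\<Sum>j\<le>k. a * c j * (shifted_laplacian ^^ j) u x)
      = (\<Sum>j\<le>Suc k. (if j \<le> k then a * c j else 0) * (shifted_laplacian ^^ j) u x)"
      by simp
    also have "(\<Sum>j\<le>Suc k. (if j = 0 then 0 else c (j - 1)) * (shifted_laplacian ^^ j) u x)
      + (\<Sum>j\<le>Suc k. (if j \<le> k then a * c j else 0) * (shifted_laplacian ^^ j) u x)
      = (\<Sum>j\<le>Suc k. c' j * (shifted_laplacian ^^ j) u x)"
      unfolding c'_def sum.distrib[symmetric] by (intro sum.cong) (auto simp: algebra_simps)
    finally show "gjms (Suc k) u x = (\<Sum>j\<le>Suc k. c' j * (shifted_laplacian ^^ j) u x)" .
  qed
  ultimately show ?case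
    by blast
qed

lemma gjms_form_ge:
  "\<exists>c>0. \<forall>u :: real ^ 'n \<Rightarrow> real. smooth_cc u \<longrightarrow>
    c * laplacian_form k u \<le> (\<integral>x. gjms k u x * u x \<partial>hyp_volume)
      - (\<Prod>i=1..k. (2 * real i - 1)\<^sup>2 / 4) * (\<integral>x. (u x)\<^sup>2 \<partial>hyp_volume)"
proof -
  obtain c :: "nat \<Rightarrow> real" where c0: "c 0 = (\<Prod>i=1..k. (2 * real i - 1)\<^sup>2 / 4)" and c_pos: "\<And>j. j \<le> k \<Longrightarrow> 0 < c j"
    and c: "\<And>u :: real ^ 'n \<Rightarrow> real. smooth_cc u \<Longrightarrow> gjms k u = (\<lambda>x. \<Sum>j\<le>k. c j * (shifted_laplacian ^^ j) u x)"
    using gjms_expansion[where ?'n='n, of k] by blast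
  \<comment> \<open>Once the term j = 0 has cancelled against the subtracted integral, all remaining
    forms are nonnegative, so their coefficients may be lowered to the minimum.\<close>
  define m where "m = Min (c ` {..k})"
  have m: "0 < m" "\<And>j. j \<le> k \<Longrightarrow> m \<le> c j"
    using c_pos by (auto simp: m_def)
  have "m * laplacian_form k u \<le> (\<integral>x. gjms k u x * u x \<partial>hyp_volume) - c 0 * (\<integral>x. (u x)\<^sup>2 \<partial>hyp_volume)"
    if u: "smooth_cc u" for u :: "real ^ 'n \<Rightarrow> real"
  proof -
    let ?L = "\<lambda>j. \<integral>x. (shifted_laplacian ^^ j) u x * u x \<partial>hyp_volume"
    have int: "integrable hyp_volume (\<lambda>x. (shifted_laplacian ^^ j) u x * u x)" for j
      using u by (intro integrable_hyp_volume cc_ball_mult smooth_cc_cc cc_ball_continuous smooth_cc_iterate)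
    have "(\<integral>x. gjms k u x * u x \<partial>hyp_volume) = (\<integral>x. (\<Sum>j\<le>k. c j * ((shifted_laplacian ^^ j) u x * u x)) \<partial>hyp_volume)"
      unfolding c[OF u] by (simp add: sum_distrib_right mult.assoc)
    also have "\<dots> = (\<Sum>j\<le>k. c j * ?L j)"
      using int by simp
    also have "\<dots> = c 0 * ?L 0 + (\<Sum>j=1..k. c j * ?L j)"
      by (simp add: atMost_atLeast0 sum.atLeast_Suc_atMost)
    also have "?L 0 = (\<integral>x. (u x)\<^sup>2 \<partial>hyp_volume)"
      by (simp add: power2_eq_square)
    finally have "(\<integral>x. gjms k u x * u x \<partial>hyp_volume) - c 0 * (\<integral>x. (u x)\<^sup>2 \<partial>hyp_volume) = (\<Sum>j=1..k. c j * ?L j)"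
      by simp
    moreover have "m * laplacian_form k u \<le> (\<Sum>j=1..k. c j * ?L j)"
      unfolding laplacian_form_def sum_distrib_left using m u
      by (intro sum_mono mult_right_mono iterate_nonneg) auto
    ultimately show ?thesis
      by simp
  qed
  then show ?thesis
    using m(1) unfolding c0 by blast
qed

section \<open>Extension by zero\<close>

text \<open>Values of u off the ball are arbitrary, so u is first cut off there. Smoothness can be
  checked on two open sets covering the space: the ball, and the complement of the closed support,
  where the extension is zero.\<close>

lemma test_function_extend:
  assumes "u \<in> test_functions (poincare_ball :: (real ^ 'n) set)"
  shows "smooth_cc (\<lambda>x. if x \<in> poincare_ball then u x else 0)"
proof -
  let ?v = "\<lambda>x. if x \<in> poincare_ball then u x else 0"
  define K where "K = closure {x \<in> poincare_ball. u x \<noteq> 0}"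
  have K: "compact K" "K \<subseteq> poincare_ball" and u: "smooth_on poincare_ball u"
    using assms by (auto simp: test_functions_def K_def)
  have v: "?v x = 0" if "x \<notin> K" for x
    using that closure_subset[of "{x \<in> poincare_ball. u x \<noteq> 0}"] by (auto simp: K_def)
  have "Ck_on m UNIV ?v" for m
  proof -
    have K': "open (- K)"
      using K by (simp add: compact_imp_closed open_Compl)
    have "Ck_on m poincare_ball ?v \<longleftrightarrow> Ck_on m poincare_ball u"
      by (rule Ck_on_cong) auto
    moreover have "Ck_on m (- K) ?v \<longleftrightarrow> Ck_on m (- K) (\<lambda>x. 0)"
      by (rule Ck_on_cong[OF K']) (use v in auto)
    ultimately have "Ck_on m (poincare_ball \<union> - K) ?v"
      using u K' Ck_on_const[of m "- K" 0] by (intro Ck_on_Un) (auto simp: smooth_on_def)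
    moreover have "poincare_ball \<union> - K = UNIV"
      using K by auto
    ultimately show ?thesis
      by simp
  qed
  then show ?thesis
    using K v unfolding smooth_cc_def smooth_on_def by blast
qed

lemma conf_laplacian_cong:
  fixes f g :: "real ^ 'n \<Rightarrow> real"
  assumes "open S" "\<And>x. x \<in> S \<Longrightarrow> f x = g x" "x \<in> S"
  shows "conf_laplacian f x = conf_laplacian g x"
proof -
  have 1: "partial_deriv i f y = partial_deriv i g y" if "y \<in> S" for i y
    using partial_deriv_cong(1)[OF assms(1,2) that] .
  have 2: "partial_deriv i (partial_deriv i f) x = partial_deriv i (partial_deriv i g) x" for i
    using partial_deriv_cong(1)[OF assms(1) 1 assms(3)] .
  show ?thesis
    using assms(2,3) by (simp add: conf_laplacian_def hyp_laplacian_def 1 2)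
qed

lemma gjms_cong:
  fixes f g :: "real ^ 'n \<Rightarrow> real"
  assumes "open S" "\<And>x. x \<in> S \<Longrightarrow> f x = g x" "x \<in> S"
  shows "gjms k f x = gjms k g x"
  using assms(2)
proof (induction k arbitrary: f g)
  case 0
  then show ?case
    using assms(3) by simp
next
  case (Suc k)
  have "conf_laplacian f y + real (Suc k) * real k * f y = conf_laplacian g y + real (Suc k) * real k * g y"
    if "y \<in> S" for y
    using conf_laplacian_cong[OF assms(1) Suc.prems that] Suc.prems[OF that] by simp
  then show ?case
    unfolding gjms.simps by (rule Suc.IH)
qed

lemma hyp_volume_integral_cong:
  assumes "\<And>x. x \<in> poincare_ball \<Longrightarrow> f x = g x"
  shows "(\<integral>x. f x \<partial>hyp_volume) = (\<integral>x. g x \<partial>hyp_volume)"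
  using assms by (intro Bochner_Integration.integral_cong) (auto simp: hyp_volume_def space_restrict_space)

theorem theorem1p3:
  fixes k :: nat and p :: real
  assumes "2 \<le> k" and "real k < real CARD('n::finite) / 2"
    and "2 < p" and "p \<le> 2 * real CARD('n) / (real CARD('n) - 2 * real k)"
  shows "\<exists>C>0. \<forall>u \<in> test_functions (poincare_ball :: (real ^ 'n) set).
    (\<integral>x. gjms k u x * u x \<partial>hyp_volume)
      - (\<Prod>i=1..k. (2 * real i - 1)\<^sup>2 / 4) * (\<integral>x. (u x)\<^sup>2 \<partial>hyp_volume)
    \<ge> C * (\<integral>x. \<bar>u x\<bar> powr p \<partial>hyp_volume) powr (2 / p)"
proof -
  have dim: "3 \<le> CARD('n)" "2 * k < CARD('n)"
    using assms(1,2) by auto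
  have "controlled TYPE('n) k 0 p"
  \<comment> \<open>Interpolation cannot reach down to exponent 2, where the L^2 norm is not
    controlled. Exponents up to 2n/(n-2) therefore come directly from the first order inequality,
    and only larger ones from interpolation between p_1 and p_k.\<close>
  proof (cases "p \<le> 2 * real CARD('n) / (real CARD('n) - 2)")
    case True
    then show ?thesis
      using assms dim by (intro controlled_first_order) auto
  next
    case False
    have "controlled TYPE('n) k 0 (2 * real CARD('n) / (real CARD('n) - 2 * real 1))"
      using assms by (intro controlled_iterated dim) auto
    moreover have "controlled TYPE('n) k 0 (2 * real CARD('n) / (real CARD('n) - 2 * real k))"
      using assms by (intro controlled_iterated dim) auto
    moreover have "1 \<le> 2 * real CARD('n) / (real CARD('n) - 2)"
      using dim by (simp add: field_simps)
    ultimately show ?thesis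
      using assms False by (intro controlled_interpolate[where ?'n='n and k=k and i=0 and p=p]) auto
  qed
  then obtain C where C: "0 < C" "\<And>f :: real ^ 'n \<Rightarrow> real. smooth_cc f \<Longrightarrow>
      (hyp_norm p f)\<^sup>2 \<le> C * laplacian_form k f"
    unfolding controlled_def by auto
  obtain c where c: "0 < c" "\<And>u :: real ^ 'n \<Rightarrow> real. smooth_cc u \<Longrightarrow>
      c * laplacian_form k u \<le> (\<integral>x. gjms k u x * u x \<partial>hyp_volume)
        - (\<Prod>i=1..k. (2 * real i - 1)\<^sup>2 / 4) * (\<integral>x. (u x)\<^sup>2 \<partial>hyp_volume)"
    using gjms_form_ge[where ?'n='n, of k] by blast
  have "c / C * (\<integral>x. \<bar>u x\<bar> powr p \<partial>hyp_volume) powr (2 / p) \<le> (\<integral>x. gjms k u x * u x \<partial>hyp_volume)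
      - (\<Prod>i=1..k. (2 * real i - 1)\<^sup>2 / 4) * (\<integral>x. (u x)\<^sup>2 \<partial>hyp_volume)"
    if u: "u \<in> test_functions (poincare_ball :: (real ^ 'n) set)" for u
  proof -
    \<comment> \<open>All integrals see only the open ball, where differential operators are local,
      so u may be replaced by its extension by zero.\<close>
    define v where "v = (\<lambda>x. if x \<in> poincare_ball then u x else 0)"
    have v: "smooth_cc v" "\<And>x. x \<in> poincare_ball \<Longrightarrow> u x = v x"
      using test_function_extend[OF u] by (auto simp: v_def)
    have "(\<integral>x. \<bar>u x\<bar> powr p \<partial>hyp_volume) = (\<integral>x. \<bar>v x\<bar> powr p \<partial>hyp_volume)"
      by (rule hyp_volume_integral_cong) (simp add: v(2))
    moreover have "(\<integral>x. (u x)\<^sup>2 \<partial>hyp_volume) = (\<integral>x. (v x)\<^sup>2 \<partial>hyp_volume)"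
      by (rule hyp_volume_integral_cong) (simp add: v(2))
    moreover have "(\<integral>x. gjms k u x * u x \<partial>hyp_volume) = (\<integral>x. gjms k v x * v x \<partial>hyp_volume)"
    proof (rule hyp_volume_integral_cong)
      fix x :: "real ^ 'n" assume x: "x \<in> poincare_ball"
      show "gjms k u x * u x = gjms k v x * v x"
        using gjms_cong[OF open_ball v(2) x, where k=k] v(2)[OF x] by simp
    qed
    moreover have "c / C * (\<integral>x. \<bar>v x\<bar> powr p \<partial>hyp_volume) powr (2 / p) \<le> c * laplacian_form k v"
      using C(2)[OF v(1)] C(1) c(1) assms(3) by (simp add: hyp_norm_square field_simps)
    ultimately show ?thesis
      using c(2)[OF v(1)] by simp
  qed
  moreover have "0 < c / C"
    using c(1) C(1) by simp
  ultimately show ?thesis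
    by blast
qed

end
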